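(* Let $d\ge1$ and $0\le e<d$ with $\gcd(e,d)=1$. The toric surface $V_{d,e}\cong\mathbb A^2/\!/\mathbb Z_d$ admits at most 2 conjugacy classes of $\mathbb A^1$-fibrations over $\mathbb A^1$. Moreover, there is only one such conjugacy class if and only if $e^2\equiv1\bmod d$.
   Context: Everything is over $\mathbb C$. For a primitive $d$-th root of unity $\zeta$ and $0\le e<d$ with $\gcd(e,d)=1$ (for $d=1$ this means $e=0$), the cyclic group $\mathbb Z_d=\langle\zeta\rangle$ acts on $\mathbb A^2$ via $\zeta.(x,y)=(\zeta x,\zeta^ey)$, and $V_{d,e}=\mathbb A^2/\!/\mathbb Z_d$ is the quotient, a normal affine toric surface. An $\mathbb A^1$-fibration $V\to\mathbb A^1$ is a surjective morphism with general fibre $\mathbb A^1$. Two such $\varphi,\varphi'$ are conjugate if $\varphi'=\beta\circ\varphi\circ\alpha$ with $\alpha\in\operatorname{Aut}(V)$ and $\beta\in\operatorname{Aut}(\mathbb A^1)$. *)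

theory Defs
  imports
    Complex_Main
    "HOL-Library.FuncSet"
    "HOL-Computational_Algebra.Polynomial"
    "HOL-Number_Theory.Cong"
begin

text \<open>
  A (reduced) affine variety over the complex numbers is presented by its set of closed points
  together with its algebra of regular functions.  Functions and maps on a variety are
  extensional, i.e. \<^term>\<open>undefined\<close> off the set of points, so that two maps that agree
  on all points are equal.  The record imposes no axioms; only the affine line, the affine plane,
  quotients of the plane by finite groups, and closed subsets of these are used below.
\<close>

record 'a variety =
  points :: "'a set"
  regular :: "('a \<Rightarrow> complex) set"

definition morphism :: "'a variety \<Rightarrow> 'b variety \<Rightarrow> ('a \<Rightarrow> 'b) \<Rightarrow> bool" where
  "morphism X Y \<phi> \<longleftrightarrow>
     \<phi> \<in> points X \<rightarrow>\<^sub>E points Y \<and>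
     (\<forall>g\<in>regular Y. compose (points X) g \<phi> \<in> regular X)"

definition isomorphism :: "'a variety \<Rightarrow> 'b variety \<Rightarrow> ('a \<Rightarrow> 'b) \<Rightarrow> bool" where
  "isomorphism X Y \<phi> \<longleftrightarrow>
     morphism X Y \<phi> \<and>
     (\<exists>\<psi>. morphism Y X \<psi> \<and>
        (\<forall>x\<in>points X. \<psi> (\<phi> x) = x) \<and> (\<forall>y\<in>points Y. \<phi> (\<psi> y) = y))"

definition isomorphic :: "'a variety \<Rightarrow> 'b variety \<Rightarrow> bool" where
  "isomorphic X Y \<longleftrightarrow> (\<exists>\<phi>. isomorphism X Y \<phi>)"

definition Aut :: "'a variety \<Rightarrow> ('a \<Rightarrow> 'a) set" where
  "Aut X = {\<alpha>. isomorphism X X \<alpha>}"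

definition affine_line :: "complex variety" where
  "affine_line = \<lparr>points = UNIV, regular = range poly\<rparr>"

text \<open>
  A polynomial in \<open>x\<close> and \<open>y\<close> is a polynomial in \<open>y\<close> whose coefficients are polynomials in \<open>x\<close>.
\<close>

definition affine_plane :: "(complex \<times> complex) variety" where
  "affine_plane =
     \<lparr>points = UNIV,
      regular = range (\<lambda>p :: complex poly poly. \<lambda>(x, y). poly (poly p [:y:]) x)\<rparr>"

text \<open>Closed subsets carry the reduced structure.\<close>

definition closed_subvariety :: "'a variety \<Rightarrow> 'a set \<Rightarrow> 'a variety" where
  "closed_subvariety X Z = \<lparr>points = Z, regular = (\<lambda>f. restrict f Z) ` regular X\<rparr>"

definition fibre :: "'a variety \<Rightarrow> ('a \<Rightarrow> 'b) \<Rightarrow> 'b \<Rightarrow> 'a variety" where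
  "fibre X \<phi> t = closed_subvariety X {p \<in> points X. \<phi> p = t}"

text \<open>
  For a finite group \<open>G\<close> of automorphisms of \<open>X\<close>, the points of the quotient \<open>X//G\<close> are
  the orbits, and its regular functions are the invariant regular functions on \<open>X\<close>.
\<close>

definition group_orbit :: "('a \<Rightarrow> 'a) set \<Rightarrow> 'a \<Rightarrow> 'a set" where
  "group_orbit G p = (\<lambda>g. g p) ` G"

definition quotient_variety :: "'a variety \<Rightarrow> ('a \<Rightarrow> 'a) set \<Rightarrow> 'a set variety" where
  "quotient_variety X G =
     \<lparr>points = group_orbit G ` points X,
      regular = {f \<in> extensional (group_orbit G ` points X).
                   (\<lambda>p\<in>points X. f (group_orbit G p)) \<in> regular X}\<rparr>"

definition primitive_root_of_unity :: "nat \<Rightarrow> complex \<Rightarrow> bool" where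
  "primitive_root_of_unity d \<zeta> \<longleftrightarrow> d \<ge> 1 \<and> \<zeta> ^ d = 1 \<and> (\<forall>k. 0 < k \<and> k < d \<longrightarrow> \<zeta> ^ k \<noteq> 1)"

text \<open>
  Since \<open>\<zeta>\<close> is a root of unity, the group generated by \<open>\<zeta>\<close> consists of its powers with natural
  exponents.
\<close>

definition cyclic_action :: "complex \<Rightarrow> nat \<Rightarrow> (complex \<times> complex \<Rightarrow> complex \<times> complex) set" where
  "cyclic_action \<zeta> e = (\<lambda>\<eta>. \<lambda>(x, y). (\<eta> * x, \<eta> ^ e * y)) ` range (\<lambda>k::nat. \<zeta> ^ k)"

text \<open>The surface \<open>V\<^sub>d\<^sub>,\<^sub>e\<close>, where \<open>d\<close> is the order of \<open>\<zeta>\<close>.\<close>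

definition toric_surface :: "complex \<Rightarrow> nat \<Rightarrow> (complex \<times> complex) set variety" where
  "toric_surface \<zeta> e = quotient_variety affine_plane (cyclic_action \<zeta> e)"

text \<open>
  The nonempty open subsets of the affine line are the cofinite ones.  As the base field has
  characteristic zero, the general scheme-theoretic fibre of a dominant morphism from a variety is
  reduced, so the reduced structure on the fibres gives the usual notion.
\<close>

definition A1_fibration :: "'a variety \<Rightarrow> ('a \<Rightarrow> complex) \<Rightarrow> bool" where
  "A1_fibration V \<phi> \<longleftrightarrow>
     morphism V affine_line \<phi> \<and>
     \<phi> ` points V = points affine_line \<and>
     finite {t \<in> points affine_line. \<not> isomorphic (fibre V \<phi> t) affine_line}"

definition conjugate_fibrations ::
    "'a variety \<Rightarrow> (('a \<Rightarrow> complex) \<times> ('a \<Rightarrow> complex)) set" where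
  "conjugate_fibrations V =
     {(\<phi>, \<phi>'). A1_fibration V \<phi> \<and> A1_fibration V \<phi>' \<and>
        (\<exists>\<alpha>\<in>Aut V. \<exists>\<beta>\<in>Aut affine_line. \<phi>' = compose (points V) \<beta> (compose (points V) \<phi> \<alpha>))}"

definition fibration_classes :: "'a variety \<Rightarrow> ('a \<Rightarrow> complex) set set" where
  "fibration_classes V = Collect (A1_fibration V) // conjugate_fibrations V"

lemma morphism_compose:
  assumes "morphism X Y \<phi>" "morphism Y Z \<psi>"
  shows "morphism X Z (compose (points X) \<psi> \<phi>)"
proof -
  have "compose (points X) g (compose (points X) \<psi> \<phi>) \<in> regular X" if "g \<in> regular Z" for g
  proof -
    have "compose (points X) (compose (points Y) g \<psi>) \<phi> \<in> regular X"
      using assms that by (simp add: morphism_def)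
    moreover have "compose (points X) g (compose (points X) \<psi> \<phi>)
        = compose (points X) (compose (points Y) g \<psi>) \<phi>"
      using assms by (auto simp: morphism_def compose_def fun_eq_iff)
    ultimately show ?thesis by simp
  qed
  moreover have "compose (points X) \<psi> \<phi> \<in> points X \<rightarrow>\<^sub>E points Z"
    using assms by (auto simp: morphism_def compose_def)
  ultimately show ?thesis
    by (simp add: morphism_def)
qed

lemma Aut_compose:
  assumes "\<alpha> \<in> Aut X" "\<beta> \<in> Aut X"
  shows "compose (points X) \<beta> \<alpha> \<in> Aut X"
proof -
  obtain \<alpha>' \<beta>' where
    "morphism X X \<alpha>'" "\<forall>x\<in>points X. \<alpha>' (\<alpha> x) = x" "\<forall>x\<in>points X. \<alpha> (\<alpha>' x) = x"
    "morphism X X \<beta>'" "\<forall>x\<in>points X. \<beta>' (\<beta> x) = x" "\<forall>x\<in>points X. \<beta> (\<beta>' x) = x"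
    using assms by (auto simp: Aut_def isomorphism_def)
  moreover have "morphism X X \<alpha>" "morphism X X \<beta>"
    using assms by (auto simp: Aut_def isomorphism_def)
  moreover from this have "morphism X X (compose (points X) \<beta> \<alpha>)"
    by (rule morphism_compose)
  moreover from calculation have "morphism X X (compose (points X) \<alpha>' \<beta>')"
    by (auto intro: morphism_compose)
  moreover have "\<forall>x\<in>points X. f x \<in> points X" if "morphism X X f" for f
    using that by (auto simp: morphism_def)
  ultimately show ?thesis
    unfolding Aut_def isomorphism_def
    by (intro CollectI conjI exI[of _ "compose (points X) \<alpha>' \<beta>'"]) (auto simp: compose_def)
qed

lemma Aut_id:
  assumes "regular X \<subseteq> extensional (points X)"
  shows "(\<lambda>x\<in>points X. x) \<in> Aut X"
proof -
  have "compose (points X) g (\<lambda>x\<in>points X. x) = g" if "g \<in> regular X" for g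
    using that assms by (auto simp: compose_def fun_eq_iff extensional_def)
  then have "morphism X X (\<lambda>x\<in>points X. x)"
    by (auto simp: morphism_def)
  then show ?thesis
    by (auto simp: Aut_def isomorphism_def intro!: exI[of _ "\<lambda>x\<in>points X. x"])
qed

lemma Aut_inverse:
  assumes "\<alpha> \<in> Aut X"
  obtains \<alpha>' where "\<alpha>' \<in> Aut X" "\<forall>x\<in>points X. \<alpha>' (\<alpha> x) = x" "\<forall>x\<in>points X. \<alpha> (\<alpha>' x) = x"
  using assms by (auto simp: Aut_def isomorphism_def)

lemma Aut_points: "\<alpha> \<in> Aut X \<Longrightarrow> x \<in> points X \<Longrightarrow> \<alpha> x \<in> points X"
  by (auto simp: Aut_def isomorphism_def morphism_def)

lemma equiv_conjugate_fibrations: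
  assumes "regular V \<subseteq> extensional (points V)"
  shows "equiv (Collect (A1_fibration V)) (conjugate_fibrations V)"
proof (rule equivI)
  have line: "(\<lambda>t. t) \<in> Aut affine_line"
    using Aut_id[of affine_line] by (simp add: affine_line_def restrict_def)
  have ext: "\<phi> \<in> extensional (points V)" if "A1_fibration V \<phi>" for \<phi>
    using that by (auto simp: A1_fibration_def morphism_def PiE_def)
  have all_line: "t \<in> points affine_line" for t
    by (simp add: affine_line_def)
  show "conjugate_fibrations V \<subseteq> Collect (A1_fibration V) \<times> Collect (A1_fibration V)"
    by (auto simp: conjugate_fibrations_def)
  show "refl_on (Collect (A1_fibration V)) (conjugate_fibrations V)"
  proof (rule refl_onI)
    fix \<phi> assume "\<phi> \<in> Collect (A1_fibration V)"
    then have "A1_fibration V \<phi>" by simp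
    moreover from ext[OF this]
    have "\<phi> = compose (points V) (\<lambda>t. t) (compose (points V) \<phi> (\<lambda>x\<in>points V. x))"
      by (simp add: compose_def restrict_def extensional_def fun_eq_iff)
    ultimately show "(\<phi>, \<phi>) \<in> conjugate_fibrations V"
      unfolding conjugate_fibrations_def using Aut_id[OF assms] line by blast
  qed
  show "sym (conjugate_fibrations V)"
  proof (rule symI)
    fix \<phi> \<phi>' assume "(\<phi>, \<phi>') \<in> conjugate_fibrations V"
    then obtain \<alpha> \<beta> where fib: "A1_fibration V \<phi>" "A1_fibration V \<phi>'"
      and ab: "\<alpha> \<in> Aut V" "\<beta> \<in> Aut affine_line"
      and eq: "\<phi>' = compose (points V) \<beta> (compose (points V) \<phi> \<alpha>)"
      unfolding conjugate_fibrations_def by blast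
    obtain \<alpha>' where a': "\<alpha>' \<in> Aut V" "\<forall>x\<in>points V. \<alpha>' (\<alpha> x) = x"
        "\<forall>x\<in>points V. \<alpha> (\<alpha>' x) = x"
      by (rule Aut_inverse[OF ab(1)])
    obtain \<beta>' where b': "\<beta>' \<in> Aut affine_line"
        "\<forall>t\<in>points affine_line. \<beta>' (\<beta> t) = t" "\<forall>t\<in>points affine_line. \<beta> (\<beta>' t) = t"
      by (rule Aut_inverse[OF ab(2)])
    have "\<phi> = compose (points V) \<beta>' (compose (points V) \<phi>' \<alpha>')"
    proof
      fix p
      show "\<phi> p = compose (points V) \<beta>' (compose (points V) \<phi>' \<alpha>') p"
      proof (cases "p \<in> points V")
        case True
        then have "\<beta>' (\<beta> (\<phi> (\<alpha> (\<alpha>' p)))) = \<phi> p"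
          using a'(3) b'(2) all_line by simp
        with True Aut_points[OF a'(1) True] show ?thesis
          by (simp only: eq compose_def restrict_apply' if_True)
      next
        case False
        then show ?thesis
          using extensional_arb[OF ext[OF fib(1)]] by (simp add: compose_def)
      qed
    qed
    with fib a'(1) b'(1) show "(\<phi>', \<phi>) \<in> conjugate_fibrations V"
      unfolding conjugate_fibrations_def by blast
  qed
  show "trans (conjugate_fibrations V)"
  proof (rule transI)
    fix \<phi> \<chi> \<psi>
    assume "(\<phi>, \<chi>) \<in> conjugate_fibrations V" "(\<chi>, \<psi>) \<in> conjugate_fibrations V"
    then obtain \<alpha> \<beta> \<alpha>' \<beta>' where fib: "A1_fibration V \<phi>" "A1_fibration V \<psi>"
      and ab: "\<alpha> \<in> Aut V" "\<beta> \<in> Aut affine_line" "\<alpha>' \<in> Aut V" "\<beta>' \<in> Aut affine_line"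
      and eq: "\<chi> = compose (points V) \<beta> (compose (points V) \<phi> \<alpha>)"
        "\<psi> = compose (points V) \<beta>' (compose (points V) \<chi> \<alpha>')"
      unfolding conjugate_fibrations_def by blast
    have "\<psi> = compose (points V) (compose (points affine_line) \<beta>' \<beta>)
                (compose (points V) \<phi> (compose (points V) \<alpha> \<alpha>'))"
    proof
      fix p
      show "\<psi> p = compose (points V) (compose (points affine_line) \<beta>' \<beta>)
                (compose (points V) \<phi> (compose (points V) \<alpha> \<alpha>')) p"
        using Aut_points[OF ab(3), of p] all_line by (simp add: eq compose_def)
    qed
    with fib Aut_compose[OF ab(3,1)] Aut_compose[OF ab(2,4)]
    show "(\<phi>, \<psi>) \<in> conjugate_fibrations V"
      unfolding conjugate_fibrations_def by blast
  qed
qed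

lemma equiv_conjugate_fibrations_toric_surface:
  "equiv (Collect (A1_fibration (toric_surface \<zeta> e))) (conjugate_fibrations (toric_surface \<zeta> e))"
  by (rule equiv_conjugate_fibrations) (auto simp: toric_surface_def quotient_variety_def)

end

theory Submission
  imports Defs "HOL-Computational_Algebra.Computational_Algebra" "HOL-Computational_Algebra.Field_as_Ring"
    "HOL-Analysis.Continuum_Not_Denumerable"
begin

text \<open>
  Let \<open>B\<close> be the ring of polynomials in \<open>x\<close> and \<open>y\<close>.  An \<open>A\<^sup>1\<close>-fibration of \<open>V\<close> is given by an invariant
  polynomial \<open>f \<in> B\<close>, and \<open>jac f = f\<^sub>x \<partial>\<^sub>y - f\<^sub>y \<partial>\<^sub>x\<close> is the derivation of \<open>B\<close> that is tangent to the fibres of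
  \<open>f\<close>.  The heart of the proof is that \<open>f = \<alpha> g\<^sup>d + \<beta>\<close>, where \<open>g\<close> belongs to a coordinate system
  \<open>(g, s)\<close> of the plane on which the group acts diagonally, with the weights of \<open>(x, y)\<close> or of
  \<open>(y, x)\<close>.  The coordinate change \<open>(g, s)\<close> then descends to an automorphism of \<open>V\<close>, and every
  fibration is conjugate to \<open>x\<^sup>d\<close> or to \<open>y\<^sup>d\<close> (\<open>fibration_conjugate_to_coordinate\<close>).

  The coordinates are found as follows.  The action is free off the origin, so a general fibre,
  being a line in \<open>V\<close> that avoids the image of the origin, lifts to an embedded line in the plane; the
  fibre of \<open>f\<close> consists of the translates of that line (\<open>line_fibre_parametrized\<close>).  On such a line
  \<open>jac f\<close> is a nonzero multiple of the derivative in the parameter (\<open>jac_along_line\<close>).  There are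
  uncountably many fibres but only countably many degrees, so infinitely many of the lines share
  a degree bound, and \<open>jac f\<close> is locally nilpotent (\<open>jac_locally_nilpotent\<close>).  An invariant
  polynomial killed by \<open>jac f\<close> is constant on the fibres and hence a polynomial in \<open>f\<close>
  (\<open>invariant_kernel\<close>).  Taking norms over the group, every element of the kernel of \<open>jac f\<close> is seen
  to be constant on the fibre through the origin, so a prime factor \<open>g\<close> of \<open>f - f(0)\<close> generates
  the kernel (\<open>kernel_generator\<close>) and is semi-invariant.  All \<open>g - c\<close> are prime, and this is what
  makes a local slice of least degree a slice \<open>s\<close>, that is, \<open>jac g s = 1\<close> (\<open>slice_exists\<close>); then
  \<open>B = \<complex>[g, s]\<close>.  Averaging over the group makes \<open>s\<close> semi-invariant, and the linear terms at the
  origin determine the weights of \<open>g\<close> and \<open>s\<close> (\<open>coordinate_weights\<close>).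

  It remains to compare \<open>x\<^sup>d\<close> with \<open>y\<^sup>d\<close>.  If \<open>e\<^sup>2 \<equiv> 1\<close>, then swapping \<open>x\<close> and \<open>y\<close> descends to \<open>V\<close>.
  Conversely, choose \<open>b\<close> with \<open>1 + e b \<equiv> 0\<close>, so that \<open>x y\<^sup>b\<close> is invariant.  Along an automorphism that
  conjugates the fibrations, \<open>x\<^sup>d\<close>, \<open>y\<^sup>d\<close> and \<open>x y\<^sup>b\<close> pull back to \<open>X\<close>, \<open>Y\<close> and \<open>U\<close> with \<open>U\<^sup>d = X Y\<^sup>b\<close>,
  where \<open>X\<close> is a multiple of \<open>y\<^sup>d\<close>.  Hence \<open>U = y w\<close>, the restriction of \<open>w\<close> to the line \<open>y = 0\<close> has
  degree \<open>b\<close>, and invariance of \<open>y w\<close> gives \<open>e + b \<equiv> 0\<close>.  Together with \<open>1 + e b \<equiv> 0\<close> this is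
  \<open>e\<^sup>2 \<equiv> 1\<close>.
\<close>

section \<open>Polynomials in two variables\<close>

type_synonym bipoly = "complex poly poly"

definition ev :: "bipoly \<Rightarrow> complex \<Rightarrow> complex \<Rightarrow> complex" where
  "ev h x y = poly (poly h [:y:]) x"

definition const :: "complex \<Rightarrow> bipoly" where
  "const c = [:[:c:]:]"

definition X_var :: bipoly where "X_var = [:[:0, 1:]:]"
definition Y_var :: bipoly where "Y_var = [:0, 1:]"

lemma ev_simps [simp]:
  "ev 0 x y = 0" "ev 1 x y = 1" "ev (h + k) x y = ev h x y + ev k x y"
  "ev (h - k) x y = ev h x y - ev k x y" "ev (- h) x y = - ev h x y"
  "ev (h * k) x y = ev h x y * ev k x y" "ev (h ^ n) x y = ev h x y ^ n"
  "ev (const c) x y = c" "ev X_var x y = x" "ev Y_var x y = y"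
  by (simp_all add: ev_def const_def X_var_def Y_var_def)

lemma ev_prod [simp]: "ev (prod F A) x y = (\<Prod>k\<in>A. ev (F k) x y)"
  by (induction A rule: infinite_finite_induct) auto

lemma ev_sum [simp]: "ev (sum F A) x y = (\<Sum>k\<in>A. ev (F k) x y)"
  by (induction A rule: infinite_finite_induct) auto

lemma ev_pCons: "ev (pCons c h) x y = poly c x + y * ev h x y"
  by (simp add: ev_def)

lemma ev_eq_poly_map_poly: "ev h x y = poly (map_poly (\<lambda>c. poly c x) h) y"
  by (induction h) (simp_all add: ev_pCons map_poly_pCons)

text \<open>
  Polynomial identities are checked pointwise throughout; this turns each of them into an
  identity between complex numbers.
\<close>

lemma ev_eqI:
  assumes "\<And>x y. ev h x y = ev k x y"
  shows "h = k"
proof (rule poly_eqI)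
  fix n
  have "map_poly (\<lambda>c. poly c x) h = map_poly (\<lambda>c. poly c x) k" for x
    using assms by (simp add: ev_eq_poly_map_poly poly_eq_poly_eq_iff[symmetric] fun_eq_iff)
  then have "poly (coeff h n) x = poly (coeff k n) x" for x
    by (metis coeff_map_poly poly_0)
  then show "coeff h n = coeff k n"
    by (simp add: poly_eq_poly_eq_iff[symmetric] fun_eq_iff)
qed

lemma const_simps [simp]:
  "const 0 = 0" "const 1 = 1" "const a = const b \<longleftrightarrow> a = b" "const a = 0 \<longleftrightarrow> a = 0"
  by (simp_all add: const_def one_pCons)

definition subst :: "bipoly \<Rightarrow> bipoly \<Rightarrow> bipoly \<Rightarrow> bipoly" where
  "subst h u v = poly (map_poly (\<lambda>c. poly (map_poly const c) u) h) v"

lemma ev_subst [simp]: "ev (subst h u v) x y = ev h (ev u x y) (ev v x y)"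
proof -
  have "ev (poly (map_poly const c) u) x y = poly c (ev u x y)" for c
    by (induction c) (simp_all add: map_poly_pCons)
  then show ?thesis
    by (induction h) (simp_all add: subst_def map_poly_pCons ev_pCons)
qed

definition along :: "bipoly \<Rightarrow> complex poly \<Rightarrow> complex poly \<Rightarrow> complex poly" where
  "along h p q = poly (map_poly (\<lambda>c. pcompose c p) h) q"

lemma poly_along [simp]: "poly (along h p q) s = ev h (poly p s) (poly q s)"
  by (induction h) (simp_all add: along_def map_poly_pCons ev_pCons poly_pcompose)

section \<open>Partial derivatives and the Jacobian derivation\<close>

definition dx :: "bipoly \<Rightarrow> bipoly" where "dx = map_poly pderiv"
definition dy :: "bipoly \<Rightarrow> bipoly" where "dy = pderiv"

lemma dx_pCons: "dx (pCons c h) = pCons (pderiv c) (dx h)"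
  by (simp add: dx_def map_poly_pCons)

text \<open>
  The complex derivative is used only to transport the chain rule: together with uniqueness of
  derivatives it yields all rules for the formal partial derivatives.
\<close>

lemma ev_chain_rule:
  assumes "(u has_field_derivative u') (at s)" "(v has_field_derivative v') (at s)"
  shows "((\<lambda>s. ev h (u s) (v s)) has_field_derivative
           (ev (dx h) (u s) (v s) * u' + ev (dy h) (u s) (v s) * v')) (at s)"
proof (induction h)
  case 0
  show ?case by (simp add: dx_def dy_def)
next
  case (pCons c h)
  have "((\<lambda>s. poly c (u s)) has_field_derivative (poly (pderiv c) (u s) * u')) (at s)"
    by (rule DERIV_chain2[OF poly_DERIV assms(1)])
  from DERIV_add[OF this DERIV_mult[OF assms(2) pCons.IH]]
  show ?case
    by (simp add: ev_pCons dx_pCons dy_def pderiv_pCons algebra_simps)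
qed

lemma ev_dx: "((\<lambda>x. ev h x y) has_field_derivative ev (dx h) x y) (at x)"
  using ev_chain_rule[of "\<lambda>x. x" 1 x "\<lambda>_. y" 0 h] by (simp add: DERIV_ident)

lemma ev_dy: "((\<lambda>y. ev h x y) has_field_derivative ev (dy h) x y) (at y)"
  using ev_chain_rule[of "\<lambda>_. x" 0 y "\<lambda>y. y" 1 h] by (simp add: DERIV_ident)

lemma dx_eqI:
  assumes "\<And>x y. ((\<lambda>x. ev h x y) has_field_derivative ev k x y) (at x)"
  shows "dx h = k"
  by (rule ev_eqI, rule DERIV_unique[OF ev_dx assms])

lemma dy_eqI:
  assumes "\<And>x y. ((\<lambda>y. ev h x y) has_field_derivative ev k x y) (at y)"
  shows "dy h = k"
  by (rule ev_eqI, rule DERIV_unique[OF ev_dy assms])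

lemma dx_simps [simp]:
  "dx 0 = 0" "dx (const c) = 0" "dx X_var = 1" "dx Y_var = 0"
  "dx (h + k) = dx h + dx k" "dx (h - k) = dx h - dx k" "dx (h * k) = dx h * k + h * dx k"
  by (rule dx_eqI; (auto intro!: derivative_eq_intros ev_dx))+

lemma dy_simps [simp]:
  "dy 0 = 0" "dy (const c) = 0" "dy X_var = 0" "dy Y_var = 1"
  "dy (h + k) = dy h + dy k" "dy (h - k) = dy h - dy k" "dy (h * k) = dy h * k + h * dy k"
  by (rule dy_eqI; (auto intro!: derivative_eq_intros ev_dy))+

lemma dx_subst: "dx (subst h u v) = subst (dx h) u v * dx u + subst (dy h) u v * dx v"
  by (rule dx_eqI) (use ev_chain_rule[OF ev_dx ev_dx] in simp)

lemma dy_subst: "dy (subst h u v) = subst (dx h) u v * dy u + subst (dy h) u v * dy v"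
  by (rule dy_eqI) (use ev_chain_rule[OF ev_dy ev_dy] in simp)

lemma poly_pderiv_along:
  "poly (pderiv (along h p q)) s =
     ev (dx h) (poly p s) (poly q s) * poly (pderiv p) s +
     ev (dy h) (poly p s) (poly q s) * poly (pderiv q) s"
proof -
  have "((\<lambda>s. poly (along h p q) s) has_field_derivative poly (pderiv (along h p q)) s) (at s)"
    by (rule poly_DERIV)
  moreover have "((\<lambda>s. poly (along h p q) s) has_field_derivative
     (ev (dx h) (poly p s) (poly q s) * poly (pderiv p) s +
     ev (dy h) (poly p s) (poly q s) * poly (pderiv q) s)) (at s)"
    by (simp add: ev_chain_rule poly_DERIV)
  ultimately show ?thesis by (rule DERIV_unique)
qed

definition jac :: "bipoly \<Rightarrow> bipoly \<Rightarrow> bipoly" where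
  "jac u v = dx u * dy v - dy u * dx v"

lemma jac_simps [simp]:
  "jac u 0 = 0" "jac u (const c) = 0" "jac u u = 0"
  "jac u (h + k) = jac u h + jac u k" "jac u (h - k) = jac u h - jac u k"
  by (simp_all add: jac_def algebra_simps)

lemma jac_mult: "jac u (h * k) = jac u h * k + h * jac u k"
  by (simp add: jac_def algebra_simps)

lemma jac_power: "jac u h = 0 \<Longrightarrow> jac u (h ^ n) = 0"
  by (induction n) (simp_all add: jac_mult, metis const_simps(2) jac_simps(2))

lemma jac_sum: "jac u (sum F A) = (\<Sum>k\<in>A. jac u (F k))"
  by (induction A rule: infinite_finite_induct) auto

lemma jac_prod_eq_0:
  assumes "\<And>k. k \<in> A \<Longrightarrow> jac u (F k) = 0"
  shows "jac u (prod F A) = 0"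
  using assms
  by (induction A rule: infinite_finite_induct)
     (auto simp: jac_mult, (metis const_simps(2) jac_simps(2))+)

lemma jac_subst_right:
  "jac w (subst h u v) = subst (dx h) u v * jac w u + subst (dy h) u v * jac w v"
  by (simp add: jac_def dx_subst dy_subst algebra_simps)

definition subst1 :: "complex poly \<Rightarrow> bipoly \<Rightarrow> bipoly" where
  "subst1 U g = subst [:U:] g g"

lemma ev_subst1 [simp]: "ev (subst1 U g) x y = poly U (ev g x y)"
  by (simp add: subst1_def ev_pCons)

lemma subst1_simps [simp]:
  "subst1 0 g = 0" "subst1 [:c:] g = const c" "subst1 (U + V) g = subst1 U g + subst1 V g"
  "subst1 (U * V) g = subst1 U g * subst1 V g" "subst1 (U ^ n) g = subst1 U g ^ n"
  "subst1 [:0, 1:] g = g" "subst1 1 g = 1"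
  by (rule ev_eqI; simp)+

lemma subst1_linear [simp]: "subst1 [:- c, 1:] g = g - const c"
  by (rule ev_eqI) simp

lemma dx_subst1: "dx (subst1 U g) = subst1 (pderiv U) g * dx g"
  and dy_subst1: "dy (subst1 U g) = subst1 (pderiv U) g * dy g"
proof -
  have *: "subst (dx [:U:]) g g = subst1 (pderiv U) g" "subst (dy [:U:]) g g = 0"
    by (rule ev_eqI; simp add: dx_pCons dy_def pderiv_pCons ev_pCons)+
  show "dx (subst1 U g) = subst1 (pderiv U) g * dx g" "dy (subst1 U g) = subst1 (pderiv U) g * dy g"
    by (simp_all add: subst1_def[of U] dx_subst dy_subst *)
qed

lemma jac_subst1_right [simp]: "jac w (subst1 U g) = subst1 (pderiv U) g * jac w g"
  by (simp add: jac_def dx_subst1 dy_subst1 algebra_simps)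

lemma jac_subst1_left: "jac (subst1 U g) w = subst1 (pderiv U) g * jac g w"
  by (simp add: jac_def dx_subst1 dy_subst1 algebra_simps)

lemma ev_power_derivatives:
  "ev (dx (h ^ n)) x y = of_nat n * ev h x y ^ (n - 1) * ev (dx h) x y"
  "ev (dy (h ^ n)) x y = of_nat n * ev h x y ^ (n - 1) * ev (dy h) x y"
proof -
  have "((\<lambda>x. ev (h ^ n) x y) has_field_derivative of_nat n * ev h x y ^ (n - 1) * ev (dx h) x y) (at x)"
    using DERIV_power[OF ev_dx[of h y x], of n] by (simp add: ac_simps)
  then show "ev (dx (h ^ n)) x y = of_nat n * ev h x y ^ (n - 1) * ev (dx h) x y"
    by (rule DERIV_unique[OF ev_dx])
  have "((\<lambda>y. ev (h ^ n) x y) has_field_derivative of_nat n * ev h x y ^ (n - 1) * ev (dy h) x y) (at y)"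
    using DERIV_power[OF ev_dy[of h x y], of n] by (simp add: ac_simps)
  then show "ev (dy (h ^ n)) x y = of_nat n * ev h x y ^ (n - 1) * ev (dy h) x y"
    by (rule DERIV_unique[OF ev_dy])
qed

lemma jac_const_mult_left: "jac (const c * u) v = const c * jac u v"
  by (simp add: jac_def algebra_simps)

lemma is_unit_bipoly_iff: "is_unit (h :: bipoly) \<longleftrightarrow> (\<exists>c. c \<noteq> 0 \<and> h = const c)"
  by (auto simp: is_unit_poly_iff const_def dvd_field_iff)

lemma minus_const_nonconst:
  assumes "\<And>c. f \<noteq> const c"
  shows "f - const t \<noteq> const c"
proof
  assume "f - const t = const c"
  then have "f = const c + const t" by (simp add: diff_eq_eq)
  also have "\<dots> = const (c + t)" by (rule ev_eqI) simp
  finally show False using assms by blast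
qed

lemma poly_linear_remainder: "\<exists>p1. (p :: complex poly) = [:- c, 1:] * p1 + [:poly p c:]"
proof -
  have "[:- c, 1:] dvd p - [:poly p c:]" by (simp add: poly_eq_0_iff_dvd[symmetric])
  then obtain p1 where "p - [:poly p c:] = [:- c, 1:] * p1" by (elim dvdE)
  then show ?thesis by (metis diff_eq_eq)
qed

section \<open>A degree that drops under division\<close>

text \<open>
  The exponents of the leading monomial in the lexicographic order with \<open>y > x\<close>, added up.  Unlike
  \<^const>\<open>degree\<close> it detects polynomials in \<open>x\<close> alone, and unlike the total degree it is visibly additive.
\<close>

definition mdeg :: "bipoly \<Rightarrow> nat" where
  "mdeg h = degree h + degree (lead_coeff h)"

lemma mdeg_mult: "h \<noteq> 0 \<Longrightarrow> k \<noteq> 0 \<Longrightarrow> mdeg (h * k) = mdeg h + mdeg k"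
  unfolding mdeg_def lead_coeff_mult by (simp add: degree_mult_eq)

lemma mdeg_eq_0_iff: "mdeg h = 0 \<longleftrightarrow> (\<exists>c. h = const c)"
proof
  assume "mdeg h = 0"
  then have "degree h = 0" "degree (coeff h 0) = 0" by (auto simp: mdeg_def)
  then show "\<exists>c. h = const c"
    by (metis const_def degree_eq_zeroE coeff_pCons_0)
qed (auto simp: mdeg_def const_def)

lemma mdeg_minus_const: "mdeg (h - const c) \<le> mdeg h"
proof (cases "degree h = 0")
  case True
  then obtain h0 where "h = [:h0:]" by (rule degree_eq_zeroE)
  then show ?thesis
    by (simp add: mdeg_def const_def degree_diff_le)
next
  case False
  then have "degree (h + const (- c)) = degree h" "coeff (h + const (-c)) (degree h) = lead_coeff h"
    by (auto simp: const_def degree_add_eq_left coeff_pCons split: nat.splits)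
  moreover have "h - const c = h + const (- c)" by (rule ev_eqI) simp
  ultimately show ?thesis unfolding mdeg_def by (metis order_refl)
qed

section \<open>Plane curves and their generic fibres\<close>

lemma complex_root_exists:
  assumes "degree (p :: complex poly) > 0"
  obtains z where "poly p z = 0"
  using alg_closed_imp_poly_has_root[OF assms] by blast

text \<open>
  This is Bezout's identity over the field of rational functions in \<open>x\<close>, with denominators
  cleared.  A combination \<open>w\<close> of \<open>u\<close> and \<open>h\<close> of least degree in \<open>y\<close> divides both of them up to factors
  from \<open>\<complex>[x]\<close>, by pseudo-division; as \<open>u\<close> is prime and does not divide \<open>h\<close>, that degree is zero.
\<close>

lemma bezout_curve:
  fixes u h :: bipoly
  assumes "prime_elem u" "degree u > 0" "\<not> u dvd h"
  obtains \<alpha> \<beta> a where "a \<noteq> 0" "\<alpha> * u + \<beta> * h = [:a:]"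
proof -
  define I where "I = {w. w \<noteq> 0 \<and> (\<exists>\<alpha> \<beta>. w = \<alpha> * u + \<beta> * h)}"
  have "u = 1 * u + 0 * h" by simp
  moreover have "u \<noteq> 0" using assms(2) by auto
  ultimately have "u \<in> I" unfolding I_def by blast
  then obtain w where w: "w \<in> I" and min: "\<And>w'. w' \<in> I \<Longrightarrow> degree w \<le> degree w'"
    using ex_has_least_nat[of "\<lambda>w. w \<in> I" u degree] by blast
  obtain \<alpha> \<beta> where w_eq: "w = \<alpha> * u + \<beta> * h" and "w \<noteq> 0" using w by (auto simp: I_def)
  (* The remainder of pseudo-division by w is again a combination of u and h, hence zero. *)
  have dvd: "\<exists>c. c \<noteq> 0 \<and> w dvd [:c:] * v" if v: "v = \<alpha>' * u + \<beta>' * h" for v \<alpha>' \<beta>'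
  proof -
    obtain q r where qr: "pseudo_divmod v w = (q, r)" by (cases "pseudo_divmod v w") auto
    define c where "c = lead_coeff w ^ (Suc (degree v) - degree w)"
    have 1: "smult c v = w * q + r" and 2: "r = 0 \<or> degree r < degree w"
      using pseudo_divmod[OF \<open>w \<noteq> 0\<close> qr] by (auto simp: c_def)
    have "r = ([:c:] * \<alpha>' - q * \<alpha>) * u + ([:c:] * \<beta>' - q * \<beta>) * h"
      using 1 by (simp add: v w_eq algebra_simps smult_add_right)
    then have "r \<noteq> 0 \<Longrightarrow> r \<in> I" unfolding I_def by blast
    with 2 min[of r] have "r = 0" by fastforce
    moreover have "c \<noteq> 0" using \<open>w \<noteq> 0\<close> by (simp add: c_def)
    ultimately show ?thesis using 1 by (intro exI[of _ c]) auto
  qed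
  have "degree w = 0"
  proof (rule ccontr)
    assume "degree w \<noteq> 0"
    have "u = 1 * u + 0 * h" "h = 0 * u + 1 * h" by simp_all
    from dvd[OF this(1)] dvd[OF this(2)]
    obtain c c' where c: "c \<noteq> 0" "w dvd [:c:] * u" "c' \<noteq> 0" "w dvd [:c':] * h" by blast
    from c(2) obtain w1 where w1: "[:c:] * u = w * w1" by (elim dvdE)
    have "u dvd [:c:] * u" by (rule dvd_triv_right)
    with w1 have "u dvd w * w1" by simp
    then consider "u dvd w" | "u dvd w1" using prime_elem_dvd_multD[OF assms(1)] by blast
    then show False
    proof cases
      case 1
      then have "u dvd [:c':] * h" using c(4) by (rule dvd_trans)
      then have "u dvd [:c':]" using prime_elem_dvd_multD[OF assms(1)] assms(3) by blast
      then show False using c(3) assms(2) dvd_imp_degree_le[of u "[:c':]"] by simp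
    next
      case 2
      then obtain w2 where "w1 = u * w2" by (elim dvdE)
      with w1 have "u * [:c:] = u * (w * w2)" by (simp only: ac_simps)
      moreover have "u \<noteq> 0" using assms(2) by auto
      ultimately have "[:c:] = w * w2" by (simp only: mult_left_cancel simp_thms)
      then have "w dvd [:c:]" by (rule dvdI)
      then have "degree w \<le> degree [:c:]" using c(1) by (intro dvd_imp_degree_le) auto
      then show False using \<open>degree w \<noteq> 0\<close> by simp
    qed
  qed
  then obtain a where "w = [:a:]" by (rule degree_eq_zeroE)
  with w_eq \<open>w \<noteq> 0\<close> show ?thesis by (intro that[of a \<alpha> \<beta>]) auto
qed

lemma poly_nonroot:
  assumes "(p :: complex poly) \<noteq> 0"
  obtains z where "poly p z \<noteq> 0"
  using assms poly_all_0_iff_0 by blast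

text \<open>
  If \<open>u\<close> involves \<open>y\<close> and does not divide \<open>h\<close>, then a nonzero polynomial in \<open>x\<close> vanishes at all
  common zeros of \<open>u\<close> and \<open>h\<close>, whereas \<open>u = 0\<close> has a point over almost every \<open>x\<close>.
\<close>

theorem prime_curve_nullstellensatz:
  fixes u h :: bipoly
  assumes u: "prime_elem u" and van: "\<And>x y. ev u x y = 0 \<Longrightarrow> ev h x y = 0"
  shows "u dvd h"
proof (rule ccontr)
  assume nd: "\<not> u dvd h"
  show False
  proof (cases "degree u > 0")
    case True
    obtain \<alpha> \<beta> a where a: "a \<noteq> 0" "\<alpha> * u + \<beta> * h = [:a:]"
      using bezout_curve[OF u True nd] by blast
    have "a * lead_coeff u \<noteq> 0" using a(1) True by auto
    then obtain x where "poly (a * lead_coeff u) x \<noteq> 0" by (rule poly_nonroot)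
    then have x: "poly a x \<noteq> 0" "poly (lead_coeff u) x \<noteq> 0" by auto
    define ux where "ux = map_poly (\<lambda>c. poly c x) u"
    have "coeff ux (degree u) \<noteq> 0" using x(2) by (simp add: ux_def coeff_map_poly)
    then have "degree ux > 0" using True le_degree by fastforce
    then obtain y where "poly ux y = 0" by (rule complex_root_exists)
    then have "ev u x y = 0" by (simp add: ev_eq_poly_map_poly ux_def)
    moreover from this van have "ev h x y = 0" by blast
    ultimately have "ev (\<alpha> * u + \<beta> * h) x y = 0" by simp
    then show False using a(2) x(1) by (simp add: ev_pCons)
  next
    case False
    then obtain u0 where u0: "u = [:u0:]" by (auto elim: degree_eq_zeroE)
    have "degree u0 > 0"
    proof (rule ccontr)
      assume "\<not> degree u0 > 0"
      then obtain c where "u = const c" using u0 by (auto simp: const_def elim: degree_eq_zeroE)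
      with u show False using is_unit_bipoly_iff[of u] by (auto simp: prime_elem_def)
    qed
    then obtain x where x: "poly u0 x = 0" by (rule complex_root_exists)
    then obtain v where v: "u0 = [:- x, 1:] * v" unfolding poly_eq_0_iff_dvd by (elim dvdE)
    have uv: "u = [:[:- x, 1:]:] * [:v:]" by (simp add: u0 v)
    have "ev h x y = 0" for y using van[of x y] x by (simp add: u0 ev_pCons)
    then have "poly (map_poly (\<lambda>c. poly c x) h) y = 0" for y by (simp add: ev_eq_poly_map_poly)
    then have "map_poly (\<lambda>c. poly c x) h = 0" using poly_all_0_iff_0 by blast
    then have "poly (coeff h n) x = 0" for n by (metis coeff_0 coeff_map_poly poly_0)
    then have dh: "[:[:- x, 1:]:] dvd h" by (simp add: const_poly_dvd_iff poly_eq_0_iff_dvd)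
    have "u dvd [:[:- x, 1:]:] \<or> u dvd [:v:]"
      using prime_elem_dvd_multD[OF u] uv by (metis dvd_refl)
    moreover have "\<not> u dvd [:v:]"
    proof
      assume "u dvd [:v:]"
      then have "u0 dvd v" by (simp add: u0)
      moreover have "v \<noteq> 0" using v \<open>degree u0 > 0\<close> by auto
      moreover have "degree u0 = Suc (degree v)" unfolding v using \<open>v \<noteq> 0\<close> by (subst degree_mult_eq) auto
      ultimately show False using dvd_imp_degree_le[of u0 v] by simp
    qed
    ultimately show False using dh nd dvd_trans by blast
  qed
qed

lemma squarefree_curve_nullstellensatz:
  fixes v h :: bipoly
  assumes v: "squarefree v" and van: "\<And>x y. ev v x y = 0 \<Longrightarrow> ev h x y = 0"
  shows "v dvd h"
proof (cases "h = 0")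
  case False
  have v0: "v \<noteq> 0" using v by auto
  show ?thesis
  proof (rule multiplicity_le_imp_dvd[OF v0])
    fix p :: bipoly assume p: "prime p"
    show "multiplicity p v \<le> multiplicity p h"
    proof (cases "p dvd v")
      case True
      then have "p dvd h"
        using van by (intro prime_curve_nullstellensatz prime_imp_prime_elem[OF p]) (elim dvdE, simp)
      then have "multiplicity p h \<ge> 1"
        using p False by (intro multiplicity_geI) auto
      moreover have "multiplicity p v \<le> 1"
        using v p unfolding squarefree_factorial_semiring''[OF v0] by blast
      ultimately show ?thesis by simp
    qed (simp add: not_dvd_imp_multiplicity_0)
  qed
qed auto

lemma nonconstant_derivative:
  assumes "\<And>c. f \<noteq> const c"
  shows "dx f \<noteq> 0 \<or> dy f \<noteq> 0"
proof (rule ccontr)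
  assume "\<not> ?thesis"
  then have z: "dx f = 0" "dy f = 0" by auto
  from z(2) have "degree f = 0" by (simp add: dy_def pderiv_eq_0_iff)
  then obtain f0 where f0: "f = [:f0:]" by (rule degree_eq_zeroE)
  with z(1) have "pderiv f0 = 0" by (simp add: dx_pCons)
  then have "degree f0 = 0" by (simp add: pderiv_eq_0_iff)
  then obtain c where "f0 = [:c:]" by (rule degree_eq_zeroE)
  with f0 assms[of c] show False by (simp add: const_def)
qed

lemma dvd_minus_const_unique:
  assumes "u dvd f - const s" "u dvd f - const t" "\<not> is_unit u"
  shows "s = t"
proof (rule ccontr)
  assume "s \<noteq> t"
  have "u dvd (f - const s) - (f - const t)" by (rule dvd_diff[OF assms(1,2)])
  also have "(f - const s) - (f - const t) = const (t - s)" by (rule ev_eqI) simp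
  finally have "u dvd const (t - s)" .
  moreover have "is_unit (const (t - s))" using \<open>s \<noteq> t\<close> unfolding is_unit_bipoly_iff by auto
  ultimately show False using assms(3) dvd_trans by blast
qed

text \<open>
  The square of a prime that divides \<open>f - t\<close> makes the prime divide both partial derivatives of
  \<open>f\<close>.  One of these is nonzero and has finitely many prime factors, and no prime divides \<open>f - t\<close>
  for two values of \<open>t\<close>.
\<close>

lemma generic_fibre_squarefree:
  assumes nc: "\<And>c. f \<noteq> const c"
  shows "finite {t. \<not> squarefree (f - const t)}"
proof -
  define D where "D = (if dx f \<noteq> 0 then dx f else dy f)"
  have D: "D \<noteq> 0" using nonconstant_derivative[OF nc] by (auto simp: D_def)
  define S where "S = {p. prime p \<and> p dvd D}"
  have "S = prime_factors D" using D by (auto simp: S_def prime_factors_dvd)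
  then have "finite S" by simp
  have "\<exists>p\<in>S. p dvd f - const t" if "\<not> squarefree (f - const t)" for t
  proof -
    have "f - const t \<noteq> 0" using nc[of t] by simp
    with that obtain p where p: "prime p" "p ^ 2 dvd f - const t"
      unfolding squarefree_factorial_semiring[OF \<open>f - const t \<noteq> 0\<close>] by blast
    then obtain v where v: "f - const t = p ^ 2 * v" by (elim dvdE)
    then have f: "f = p * (p * v) + const t" by (simp add: algebra_simps power2_eq_square)
    have "p dvd dx f" "p dvd dy f" by (subst f; simp add: algebra_simps)+
    then show ?thesis using p v by (intro bexI[of _ p]) (auto simp: S_def D_def power2_eq_square)
  qed
  then obtain P where P: "\<And>t. \<not> squarefree (f - const t) \<Longrightarrow> P t \<in> S \<and> P t dvd f - const t" by metis
  have "inj_on P {t. \<not> squarefree (f - const t)}"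
  proof (rule inj_onI)
    fix s t assume st: "s \<in> {t. \<not> squarefree (f - const t)}" "t \<in> {t. \<not> squarefree (f - const t)}" "P s = P t"
    with P[of s] P[of t] show "s = t"
      by (intro dvd_minus_const_unique[of "P s" f]) (auto simp: S_def)
  qed
  moreover have "P ` {t. \<not> squarefree (f - const t)} \<subseteq> S" using P by auto
  ultimately show ?thesis using \<open>finite S\<close> finite_imageD finite_subset by metis
qed

lemma mdeg_minus_const_mult:
  assumes "\<And>c. f \<noteq> const c" "h - const c = (f - const t) * k" "h - const c \<noteq> 0"
  shows "mdeg k < mdeg h"
proof -
  have "k \<noteq> 0" "f - const t \<noteq> 0" using assms by auto
  then have "mdeg (h - const c) = mdeg (f - const t) + mdeg k" using assms(2) by (simp add: mdeg_mult)
  moreover have "mdeg (f - const t) > 0"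
    using minus_const_nonconst[OF assms(1)] by (simp flip: neq0_conv add: mdeg_eq_0_iff)
  ultimately show ?thesis using mdeg_minus_const[of h c] by simp
qed

text \<open>
  Each fibre on which \<open>h\<close> vanishes splits off a factor \<open>f - t\<close>, and the quotient still vanishes on the
  other fibres.
\<close>

lemma vanishing_on_infinitely_many_fibres:
  assumes nc: "\<And>c. f \<noteq> const c"
    and "infinite T" "\<And>t. t \<in> T \<Longrightarrow> squarefree (f - const t)"
    and "\<And>t x y. t \<in> T \<Longrightarrow> ev f x y = t \<Longrightarrow> ev h x y = 0"
  shows "h = 0"
  using assms(2-)
proof (induction "mdeg h" arbitrary: h T rule: less_induct)
  case less
  show ?case
  proof (rule ccontr)
    assume "h \<noteq> 0"
    obtain t where t: "t \<in> T" using infinite_imp_nonempty[OF less.prems(1)] by blast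
    have "f - const t dvd h"
      using less.prems(2,3)[OF t] by (intro squarefree_curve_nullstellensatz) auto
    then obtain k where k: "h = (f - const t) * k" by (elim dvdE)
    have "k = 0"
    proof (rule less.hyps)
      show "mdeg k < mdeg h" using mdeg_minus_const_mult[of f h 0 t k] nc k \<open>h \<noteq> 0\<close> by simp
      show "infinite (T - {t})" using less.prems(1) by simp
      show "ev k x y = 0" if "t' \<in> T - {t}" "ev f x y = t'" for t' x y
        using less.prems(3)[of t' x y] that by (auto simp: k)
    qed (use less.prems in auto)
    with k \<open>h \<noteq> 0\<close> show False by simp
  qed
qed

section \<open>Slices of locally nilpotent Jacobian derivations\<close>

lemma prime_dvd_subst1:
  assumes p: "prime_elem p" and "p dvd subst1 U r" "U \<noteq> 0"
  shows "\<exists>c. p dvd r - const c"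
  using assms(2,3)
proof (induction "degree U" arbitrary: U rule: less_induct)
  case less
  show ?case
  proof (cases "degree U = 0")
    case True
    then obtain c where "U = [:c:]" by (rule degree_eq_zeroE)
    then have "p dvd const c" "c \<noteq> 0" using less.prems by auto
    then have "is_unit p" using is_unit_bipoly_iff dvd_trans by blast
    with p show ?thesis by (simp add: prime_elem_def)
  next
    case False
    then obtain c where "poly U c = 0" using complex_root_exists by blast
    then obtain V where V: "U = [:- c, 1:] * V" unfolding poly_eq_0_iff_dvd by (elim dvdE)
    then have "V \<noteq> 0" using less.prems by auto
    then have "degree U = Suc (degree V)" unfolding V by (subst degree_mult_eq) auto
    moreover have "p dvd (r - const c) * subst1 V r"
      using less.prems(1) unfolding V subst1_simps(4) subst1_linear .
    then consider "p dvd r - const c" | "p dvd subst1 V r" using prime_elem_dvd_multD[OF p] by blast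
    ultimately show ?thesis using less.hyps[of V] \<open>V \<noteq> 0\<close> by auto
  qed
qed

lemma subst1_eq_0:
  assumes nc: "\<And>c. g \<noteq> const c" and "subst1 U g = 0"
  shows "U = 0"
  using assms(2)
proof (induction "degree U" arbitrary: U rule: less_induct)
  case less
  show ?case
  proof (cases "degree U = 0")
    case True
    then obtain c where "U = [:c:]" by (rule degree_eq_zeroE)
    with less.prems show ?thesis by simp
  next
    case False
    then obtain c where "poly U c = 0" using complex_root_exists by blast
    then obtain V where V: "U = [:- c, 1:] * V" unfolding poly_eq_0_iff_dvd by (elim dvdE)
    then have "V \<noteq> 0" using False by auto
    then have "degree U = Suc (degree V)" unfolding V by (subst degree_mult_eq) auto
    moreover have "(g - const c) * subst1 V g = 0"
      using less.prems(1) unfolding V subst1_simps(4) subst1_linear .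
    then have "subst1 V g = 0" using nc[of c] by simp
    ultimately show ?thesis using less.hyps[of V] \<open>V \<noteq> 0\<close> by auto
  qed
qed

lemma subst1_inject:
  assumes nc: "\<And>c. g \<noteq> const c" and "subst1 U g = subst1 V g"
  shows "U = V"
proof -
  have "subst1 (U - V) g = subst1 U g - subst1 V g" by (rule ev_eqI) simp
  then show ?thesis using subst1_eq_0[OF nc, of "U - V"] assms(2) by simp
qed

lemma subst_simps [simp]:
  "subst 0 u v = 0" "subst (h + k) u v = subst h u v + subst k u v"
  "subst (h * k) u v = subst h u v * subst k u v" "subst [:U:] u v = subst1 U u"
  by (rule ev_eqI; simp add: ev_pCons)+


lemma ex_antiderivative: "\<exists>Q'. dy Q' = Q"
proof -
  define Q' where "Q' = (\<Sum>n\<le>degree Q. monom (smult (1 / of_nat (Suc n)) (coeff Q n)) (Suc n))"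
  have *: "pderiv (monom (smult (1 / of_nat (Suc n)) a) (Suc n)) = monom a n" for a :: "complex poly" and n
  proof -
    have "of_nat (Suc n) * smult (1 / of_nat (Suc n)) a = smult (of_nat (Suc n)) (smult (1 / of_nat (Suc n)) a)"
      by (simp only: of_nat_poly mult_smult_left mult_1_left smult_1_left) simp
    also have "\<dots> = a" by (simp del: of_nat_Suc)
    finally show ?thesis by (simp add: pderiv_monom del: of_nat_Suc)
  qed
  have "pderiv Q' = (\<Sum>n\<le>degree Q. monom (coeff Q n) n)"
    unfolding Q'_def by (simp only: higher_pderiv_sum[of 1, simplified] *)
  also have "\<dots> = Q" by (rule poly_as_sum_of_monoms)
  finally show ?thesis unfolding dy_def by blast
qed

text \<open>
  Integration along the derivation.  If \<open>jac g b\<close> is \<open>Q(g, r)\<close> up to a power of \<open>a(g)\<close>, and \<open>Q'\<close> is an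
  antiderivative of \<open>Q\<close> in its second variable, then \<open>b\<close> and \<open>Q'(g, r)\<close> agree up to such a power and an
  element of the kernel, because \<open>jac g r = a(g)\<close>.
\<close>

lemma generated_by_local_slice:
  assumes kernel: "\<And>h. jac g h = 0 \<Longrightarrow> \<exists>U. h = subst1 U g"
    and r: "jac g r = subst1 a g"
    and "(jac g ^^ n) b = 0"
  shows "\<exists>k Q. subst1 a g ^ k * b = subst Q g r"
  using assms(3)
proof (induction n arbitrary: b)
  case 0
  then have "subst1 a g ^ 0 * b = subst 0 g r" by simp
  then show ?case by blast
next
  case (Suc n)
  then have "(jac g ^^ n) (jac g b) = 0" by (simp add: funpow_swap1)
  from Suc.IH[OF this] obtain k Q where kQ: "subst1 a g ^ k * jac g b = subst Q g r" by blast
  obtain Q' where Q': "dy Q' = Q" using ex_antiderivative by blast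
  have "jac g (subst1 a g ^ Suc k * b - subst Q' g r) = 0"
    using kQ by (simp add: jac_mult jac_power jac_subst_right Q' r del: power_Suc) (simp add: algebra_simps)
  from kernel[OF this] obtain U where "subst1 a g ^ Suc k * b - subst Q' g r = subst1 U g" by blast
  then have "subst1 a g ^ Suc k * b = subst (Q' + [:U:]) g r" by (simp add: algebra_simps)
  then show ?case by blast
qed

lemma bipoly_mod_linear:
  fixes Q :: bipoly
  shows "\<exists>Q1. Q = [:[:- c, 1:]:] * Q1 + map_poly (\<lambda>a. [:poly a c:]) Q"
proof (induction Q)
  case 0
  show ?case by (intro exI[of _ 0]) simp
next
  case (pCons a Q)
  then obtain Q1 where Q1: "Q = [:[:- c, 1:]:] * Q1 + map_poly (\<lambda>a. [:poly a c:]) Q" by blast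
  obtain a1 where "a = [:- c, 1:] * a1 + [:poly a c:]" using poly_linear_remainder by blast
  with Q1 have "pCons a Q = [:[:- c, 1:]:] * pCons a1 Q1 + map_poly (\<lambda>a. [:poly a c:]) (pCons a Q)"
    by (simp add: map_poly_pCons del: mult_pCons_left) (simp only: mult_pCons_left smult_pCons smult_0_left, simp)
  then show ?case by blast
qed

lemma subst1_map_poly: "subst (map_poly (\<lambda>a. [:poly a c:]) Q) g r = subst1 (map_poly (\<lambda>a. poly a c) Q) r"
proof (rule ev_eqI)
  fix x y
  have "ev (map_poly (\<lambda>a. [:poly a c:]) Q) u v = poly (map_poly (\<lambda>a. poly a c) Q) v" for u v
    by (induction Q) (simp_all add: map_poly_pCons ev_pCons)
  then show "ev (subst (map_poly (\<lambda>a. [:poly a c:]) Q) g r) x y = ev (subst1 (map_poly (\<lambda>a. poly a c) Q) r) x y"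
    by simp
qed

text \<open>
  Modulo \<open>g - c\<close>, the element \<open>Q(g, r)\<close> is the polynomial \<open>Q(c, \<cdot>)\<close> evaluated at \<open>r\<close>.  Over \<open>\<complex>\<close> this
  polynomial splits into linear factors, so if it were nonzero, the prime \<open>g - c\<close> would divide
  some \<open>r - c\<^sub>0\<close>.
\<close>

lemma dvd_subst_cases:
  assumes p: "prime_elem (g - const c)" and dvd: "g - const c dvd subst Q g r"
    and no: "\<And>c0. \<not> g - const c dvd r - const c0"
  shows "\<exists>Q'. subst Q g r = (g - const c) * subst Q' g r"
proof -
  obtain Q1 where Q1: "Q = [:[:- c, 1:]:] * Q1 + map_poly (\<lambda>a. [:poly a c:]) Q"
    using bipoly_mod_linear by blast
  let ?q = "map_poly (\<lambda>a. poly a c) Q"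
  have eq: "subst Q g r = (g - const c) * subst Q1 g r + subst1 ?q r"
    by (subst Q1) (simp only: subst_simps subst1_linear subst1_map_poly)
  then have "g - const c dvd subst1 ?q r"
    using dvd by (simp add: dvd_add_right_iff)
  then have "?q = 0" using prime_dvd_subst1[OF p] no by blast
  then show ?thesis using eq by auto
qed

text \<open>
  The reason is degree: a polynomial divides its own derivative only if that derivative is zero.
\<close>

lemma prime_curve_not_dvd_both_derivatives:
  assumes nc: "\<And>c. g \<noteq> const c"
  shows "\<not> (g - const c dvd dx g \<and> g - const c dvd dy g)"
proof
  assume *: "g - const c dvd dx g \<and> g - const c dvd dy g"
  define h where "h = g - const c"
  have nc': "h \<noteq> const c'" for c' unfolding h_def by (rule minus_const_nonconst[OF nc])
  have d: "h dvd dx h" "h dvd dy h" using * by (simp_all add: h_def)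
  then have "degree h = 0" by (simp add: dy_def)
  then obtain h0 where h0: "h = [:h0:]" by (rule degree_eq_zeroE)
  then have "degree h0 = 0" using d(1) by (simp add: dx_pCons)
  then obtain c' where "h0 = [:c':]" by (rule degree_eq_zeroE)
  then show False using h0 nc'[of c'] by (simp add: const_def)
qed

text \<open>
  Choose \<open>r\<close> with \<open>jac g r = a(g) \<noteq> 0\<close> and \<open>a\<close> of least degree, and suppose \<open>a(c) = 0\<close>.  If \<open>r\<close> is
  congruent to a constant \<open>c\<^sub>0\<close> modulo \<open>g - c\<close>, then \<open>(r - c\<^sub>0) / (g - c)\<close> contradicts minimality.
  Otherwise write \<open>a(g) = (g - c)\<^sup>m a\<^sub>1(g)\<close> with \<open>a\<^sub>1(c) \<noteq> 0\<close>.  For every \<open>b\<close> some \<open>a(g)\<^sup>k b\<close> is of the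
  form \<open>Q(g, r)\<close>; here the powers of \<open>g - c\<close> cancel, so \<open>a\<^sub>1(g)\<^sup>k b\<close> is of that form as well.
  Applying \<open>jac g\<close> shows that \<open>g - c\<close> divides \<open>jac g b\<close> for every \<open>b\<close>, in particular both partial
  derivatives of \<open>g\<close>.
\<close>

theorem slice_exists:
  assumes nc: "\<And>c. g \<noteq> const c"
    and prime: "\<And>c. prime_elem (g - const c)"
    and kernel: "\<And>h. jac g h = 0 \<Longrightarrow> \<exists>U. h = subst1 U g"
    and nil: "\<And>h. \<exists>n. (jac g ^^ n) h = 0"
  shows "\<exists>s. jac g s = 1"
proof -
  have jX: "jac g X_var = - dy g" and jY: "jac g Y_var = dx g" by (simp_all add: jac_def)
  obtain b where b: "jac g b \<noteq> 0"
    using nonconstant_derivative[OF nc] jX jY by (metis neg_0_equal_iff_equal)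
  (* The last two nonzero terms of the sequence of iterates are a local slice and its derivative. *)
  define n where "n = (LEAST n. (jac g ^^ n) b = 0)"
  have n: "(jac g ^^ n) b = 0" unfolding n_def using nil[of b] by (rule LeastI_ex)
  have n_min: "(jac g ^^ m) b \<noteq> 0" if "m < n" for m using that not_less_Least unfolding n_def by blast
  have "b \<noteq> 0" using b by auto
  with n have "n \<noteq> 0" by (metis funpow_0)
  moreover have "n \<noteq> 1" using n b by auto
  ultimately obtain m where m: "n = Suc (Suc m)" by (metis One_nat_def not0_implies_Suc)
  define r0 where "r0 = (jac g ^^ m) b"
  have "jac g (jac g r0) = 0" "jac g r0 \<noteq> 0" using n n_min[of "Suc m"] by (simp_all add: m r0_def)
  then obtain a0 where a0: "jac g r0 = subst1 a0 g" "a0 \<noteq> 0" using kernel by (metis subst1_simps(1))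
  define P where "P a \<longleftrightarrow> a \<noteq> 0 \<and> (\<exists>r. jac g r = subst1 a g)" for a
  have "P a0" using a0 by (auto simp: P_def)
  then obtain a where "P a" and min: "\<And>a'. P a' \<Longrightarrow> degree a \<le> degree a'"
    using ex_has_least_nat[of P a0 degree] by blast
  then obtain r where a: "a \<noteq> 0" "jac g r = subst1 a g" by (auto simp: P_def)
  have "degree a = 0"
  proof (rule ccontr)
    assume "degree a \<noteq> 0"
    then obtain c where c: "poly a c = 0" using complex_root_exists by blast
    let ?p = "g - const c"
    have p: "prime_elem ?p" by (rule prime)
    have no: "\<not> ?p dvd r - const c0" for c0
    proof
      assume "?p dvd r - const c0"
      then obtain r' where r': "r - const c0 = ?p * r'" by (elim dvdE)
      obtain a' where a': "a = [:- c, 1:] * a'" using c unfolding poly_eq_0_iff_dvd by (elim dvdE)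
      have "jac g (r - const c0) = ?p * jac g r'" unfolding r' jac_mult by simp
      moreover have "jac g r = ?p * subst1 a' g" unfolding a(2) a' by (simp only: subst1_simps subst1_linear)
      moreover have "jac g (r - const c0) = jac g r" by simp
      ultimately have "?p * jac g r' = ?p * subst1 a' g" by (simp only:)
      moreover have "?p \<noteq> 0" using nc[of c] by simp
      ultimately have "jac g r' = subst1 a' g" by (simp only: mult_left_cancel simp_thms)
      moreover have "a' \<noteq> 0" using a(1) a' by auto
      ultimately have "P a'" by (auto simp: P_def)
      moreover have "degree a = Suc (degree a')" unfolding a' using \<open>a' \<noteq> 0\<close> by (subst degree_mult_eq) auto
      ultimately show False using min[of a'] by simp
    qed
    obtain a1 where a1: "a = [:- c, 1:] ^ order c a * a1" "\<not> [:- c, 1:] dvd a1"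
      using order_decomp[OF a(1)] by blast
    have "poly a1 c \<noteq> 0" using a1(2) by (simp add: poly_eq_0_iff_dvd)
    have a1_ndvd: "\<not> ?p dvd subst1 a1 g"
    proof
      assume "?p dvd subst1 a1 g"
      obtain a2 where "a1 = [:- c, 1:] * a2 + [:poly a1 c:]" using poly_linear_remainder by blast
      then have "subst1 a1 g = ?p * subst1 a2 g + const (poly a1 c)"
        by (metis subst1_simps(2,3,4) subst1_linear)
      with \<open>?p dvd subst1 a1 g\<close> have "?p dvd const (poly a1 c)" by (simp add: dvd_add_right_iff)
      then have "is_unit ?p" using \<open>poly a1 c \<noteq> 0\<close> is_unit_bipoly_iff dvd_trans by blast
      with p show False by (simp add: prime_elem_def)
    qed
    have "?p dvd jac g b" for b
    proof -
      obtain n where "(jac g ^^ n) b = 0" using nil by blast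
      then obtain k Q where kQ: "subst1 a g ^ k * b = subst Q g r"
        using generated_by_local_slice[OF kernel a(2)] by blast
      have cancel: "\<exists>Q. w = subst Q g r" if "?p ^ j * w = subst Q g r" for j w Q
        using that
      proof (induction j arbitrary: Q)
        case (Suc j)
        then have "?p dvd subst Q g r" by (metis dvd_triv_left mult.assoc power_Suc)
        then obtain Q' where "subst Q g r = ?p * subst Q' g r"
          using dvd_subst_cases[OF p _ no] by blast
        with Suc.prems have "?p * (?p ^ j * w) = ?p * subst Q' g r" by (simp add: mult.assoc)
        then have "?p ^ j * w = subst Q' g r" using nc[of c] by simp
        then show ?case by (rule Suc.IH)
      qed auto
      have "subst1 a g = ?p ^ order c a * subst1 a1 g"
        by (subst a1(1)) (simp only: subst1_simps subst1_linear)
      with kQ have "?p ^ (order c a * k) * (subst1 a1 g ^ k * b) = subst Q g r"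
        by (simp add: power_mult_distrib power_mult mult.assoc)
      from cancel[OF this] obtain Q' where "subst1 a1 g ^ k * b = subst Q' g r" by blast
      then have "jac g (subst1 a1 g ^ k * b) = jac g (subst Q' g r)" by simp
      then have "subst1 a1 g ^ k * jac g b = subst (dy Q') g r * subst1 a g"
        by (simp add: jac_mult jac_power jac_subst_right a(2))
      moreover have "?p dvd subst1 a g"
        using c unfolding poly_eq_0_iff_dvd by (elim dvdE) (simp del: mult_pCons_left)
      ultimately have "?p dvd subst1 a1 g ^ k * jac g b" by simp
      then show ?thesis
        using prime_elem_dvd_multD[OF p] prime_elem_dvd_power[OF p] a1_ndvd by blast
    qed
    from this[of X_var] this[of Y_var] show False
      using prime_curve_not_dvd_both_derivatives[OF nc] by (simp add: jX jY)
  qed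
  then obtain z where z: "a = [:z:]" by (rule degree_eq_zeroE)
  have "jac g (const (1 / z) * r) = 1"
    using a by (simp add: jac_mult z) (rule ev_eqI, simp)
  then show ?thesis by blast
qed

lemma slice_generates:
  assumes kernel: "\<And>h. jac g h = 0 \<Longrightarrow> \<exists>U. h = subst1 U g"
    and nil: "\<And>h. \<exists>n. (jac g ^^ n) h = 0"
    and s: "jac g s = 1"
  shows "\<exists>Q. b = subst Q g s"
proof -
  obtain n where "(jac g ^^ n) b = 0" using nil by blast
  then have "\<exists>k Q. subst1 1 g ^ k * b = subst Q g s"
    using s by (intro generated_by_local_slice[OF kernel]) auto
  then show ?thesis by simp
qed

text \<open>
  The derivation \<open>jac g\<close> acts on relations between \<open>g\<close> and \<open>s\<close> as the derivative in the second
  variable, so a relation of least degree would involve \<open>g\<close> only.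
\<close>

lemma slice_algebraically_independent:
  assumes nc: "\<And>c. g \<noteq> const c" and s: "jac g s = 1" and "subst E g s = 0"
  shows "E = 0"
  using assms(3)
proof (induction "degree E" arbitrary: E rule: less_induct)
  case less
  have "jac g (subst E g s) = subst (dy E) g s" by (simp add: jac_subst_right s)
  with less.prems have *: "subst (dy E) g s = 0" by simp
  have "degree E = 0"
  proof (rule ccontr)
    assume "degree E \<noteq> 0"
    then have "degree (dy E) < degree E" "dy E \<noteq> 0" by (simp_all add: dy_def degree_pderiv pderiv_eq_0_iff)
    with less.hyps[of "dy E"] * show False by blast
  qed
  then obtain E0 where E0: "E = [:E0:]" by (rule degree_eq_zeroE)
  with less.prems have "subst1 E0 g = 0" by simp
  then have "E0 = 0" by (rule subst1_eq_0[OF nc])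
  with E0 show ?case by simp
qed

section \<open>The quotient of the plane by the cyclic group\<close>

lemma coprime_factor_of_power:
  fixes P Z U :: "complex poly"
  assumes d: "d > 0" and "P * Z = U ^ d" and no_common: "\<And>s. \<not> (poly P s = 0 \<and> poly Z s = 0)"
  shows "\<exists>p. P = p ^ d"
  using assms(2,3)
proof (induction "degree P" arbitrary: P U rule: less_induct)
  case less
  show ?case
  proof (cases "degree P = 0")
    case True
    then obtain c where c: "P = [:c:]" by (rule degree_eq_zeroE)
    obtain c' where "c' ^ d = c" using nth_root_exists[OF d] by blast
    then have "P = [:c':] ^ d" by (simp add: c poly_const_pow)
    then show ?thesis by blast
  next
    case False
    then obtain r where r: "poly P r = 0" using complex_root_exists by blast
    let ?L = "[:- r, 1:]"
    have "poly (P * Z) r = 0" using r by simp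
    then have "poly U r = 0" unfolding less.prems(1) using d by simp
    then obtain U' where U': "U = ?L * U'" unfolding poly_eq_0_iff_dvd by (elim dvdE)
    have "prime_elem ?L" by (rule prime_elem_linear_field_poly) simp
    moreover have "\<not> ?L dvd Z" using less.prems(2)[of r] r by (simp add: poly_eq_0_iff_dvd)
    ultimately have "coprime (?L ^ d) Z" by (simp add: prime_elem_imp_coprime)
    moreover have "?L ^ d dvd P * Z" unfolding less.prems(1) U' power_mult_distrib by (rule dvd_triv_left)
    ultimately have "?L ^ d dvd P" by (simp add: coprime_dvd_mult_left_iff)
    then obtain P' where P': "P = ?L ^ d * P'" by (elim dvdE)
    have "P \<noteq> 0" using False by auto
    then have "P' \<noteq> 0" using P' by auto
    have "degree P = d + degree P'"
      unfolding P' using \<open>P' \<noteq> 0\<close> by (subst degree_mult_eq) (auto simp: degree_power_eq)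
    have "?L ^ d * (P' * Z) = ?L ^ d * U' ^ d"
      using less.prems(1) unfolding P' U' power_mult_distrib by (simp only: mult.assoc)
    moreover have "?L ^ d \<noteq> 0" by simp
    ultimately have "P' * Z = U' ^ d" by (simp only: mult_left_cancel simp_thms)
    moreover have "\<not> (poly P' s = 0 \<and> poly Z s = 0)" for s
      using less.prems(2)[of s] by (auto simp: P')
    ultimately obtain p where "P' = p ^ d" using less.hyps[of P' U'] \<open>degree P = _\<close> d by auto
    then have "P = (?L * p) ^ d" by (simp only: P' power_mult_distrib)
    then show ?thesis by blast
  qed
qed

lemma fibre_points: "points (fibre X \<phi> t) = {P \<in> points X. \<phi> P = t}"
  by (simp add: fibre_def closed_subvariety_def)

lemma fibre_regular: "regular (fibre X \<phi> t) = (\<lambda>f. restrict f {P \<in> points X. \<phi> P = t}) ` regular X"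
  by (simp add: fibre_def closed_subvariety_def)

lemma affine_line_simps [simp]: "points affine_line = UNIV" "regular affine_line = range poly"
  by (simp_all add: affine_line_def)

locale cyclic_quotient =
  fixes d e :: nat and \<zeta> :: complex
  assumes d_pos: "d > 0" and coprime_e: "coprime e d" and primitive: "primitive_root_of_unity d \<zeta>"
begin

lemma root_power [simp]: "\<zeta> ^ d = 1"
  using primitive by (simp add: primitive_root_of_unity_def)

lemma root_nonzero [simp]: "\<zeta> \<noteq> 0"
  using root_power d_pos by (metis power_0_left not_gr0 zero_neq_one)

lemma root_power_eq_1_iff: "\<zeta> ^ n = 1 \<longleftrightarrow> d dvd n"
proof -
  have "\<zeta> ^ n = (\<zeta> ^ d) ^ (n div d) * \<zeta> ^ (n mod d)"
    by (simp only: power_mult[symmetric] power_add[symmetric] mult_div_mod_eq)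
  then have *: "\<zeta> ^ n = \<zeta> ^ (n mod d)" by simp
  have "n mod d < d" using d_pos by simp
  then have "\<zeta> ^ (n mod d) = 1 \<longleftrightarrow> n mod d = 0"
    using primitive by (metis primitive_root_of_unity_def power_0 neq0_conv)
  with * show ?thesis by (simp add: dvd_eq_mod_eq_0)
qed

lemma root_power_eq_iff: "\<zeta> ^ m = \<zeta> ^ n \<longleftrightarrow> [m = n] (mod d)"
proof -
  have *: "\<zeta> ^ m = \<zeta> ^ n \<longleftrightarrow> d dvd n - m" if "m \<le> n" for m n
  proof -
    have "\<zeta> ^ n = \<zeta> ^ m * \<zeta> ^ (n - m)" using that by (simp flip: power_add)
    then show ?thesis using root_power_eq_1_iff[of "n - m"] by auto
  qed
  show ?thesis
  proof (cases "m \<le> n")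
    case True
    then show ?thesis using *[OF True] by (metis cong_altdef_nat cong_sym_eq)
  next
    case False
    then show ?thesis using *[of n m] by (metis cong_altdef_nat nat_le_linear)
  qed
qed

lemma unity_root_is_power:
  assumes "z ^ d = 1"
  shows "\<exists>k<d. z = \<zeta> ^ k"
proof -
  have "inj_on (\<lambda>k. \<zeta> ^ k) {..<d}"
    by (rule inj_onI) (auto simp: root_power_eq_iff cong_def)
  then have "card ((\<lambda>k. \<zeta> ^ k) ` {..<d}) = d" by (simp add: card_image)
  moreover have "(\<lambda>k. \<zeta> ^ k) ` {..<d} \<subseteq> {z. z ^ d = 1}"
    by (auto simp: root_power_eq_1_iff simp flip: power_mult)
  moreover have "card {z::complex. z ^ d = 1} = d" using d_pos by (intro card_roots_unity_eq)
  moreover have "finite {z::complex. z ^ d = 1}" using d_pos by (intro finite_roots_unity) simp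
  ultimately have "(\<lambda>k. \<zeta> ^ k) ` {..<d} = {z. z ^ d = 1}" by (intro card_subset_eq) auto
  then show ?thesis using assms by blast
qed

lemma equal_powers:
  assumes "z ^ d = w ^ d"
  shows "\<exists>k<d. z = \<zeta> ^ k * w"
proof (cases "w = 0")
  case True
  with assms d_pos have "z = 0" by (metis power_0_left power_eq_0_iff not_gr0)
  with True d_pos show ?thesis by auto
next
  case False
  with assms have "(z / w) ^ d = 1" by (simp add: power_divide)
  then obtain k where "k < d" "z / w = \<zeta> ^ k" using unity_root_is_power by blast
  with False show ?thesis by (auto simp: field_simps)
qed

lemma equal_polynomial_powers:
  assumes "(z :: complex poly) ^ d = w ^ d"
  shows "\<exists>k. z = smult (\<zeta> ^ k) w"
proof -
  have "poly (\<Prod>k<d. z - smult (\<zeta> ^ k) w) s = 0" for s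
  proof -
    have "poly z s ^ d = poly w s ^ d" using assms by (metis poly_power)
    then obtain k where "k < d" "poly z s = \<zeta> ^ k * poly w s" using equal_powers by blast
    then show ?thesis by (auto simp: poly_prod)
  qed
  then have "(\<Prod>k<d. z - smult (\<zeta> ^ k) w) = 0" using poly_all_0_iff_0 by blast
  then show ?thesis by auto
qed

lemma root_e_surjective: "\<exists>k. \<zeta> ^ (e * k) = \<zeta> ^ j"
proof -
  obtain c where "[e * c = 1] (mod d)" using cong_solve_coprime_nat[OF coprime_e] by auto
  then have "[e * c * j = 1 * j] (mod d)" by (rule cong_scalar_right)
  then have "\<zeta> ^ (e * (c * j)) = \<zeta> ^ j" by (simp add: root_power_eq_iff mult.assoc)
  then show ?thesis by blast
qed

text \<open>
  An exponent that makes \<open>x y\<^sup>b\<close> invariant.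
\<close>

definition b :: nat where "b = (SOME b. d dvd 1 + e * b)"

lemma b: "d dvd 1 + e * b"
proof -
  obtain k where "\<zeta> ^ (e * k) = \<zeta> ^ (d - 1)" using root_e_surjective by blast
  then have "\<zeta> ^ (1 + e * k) = \<zeta> ^ (1 + (d - 1))" by (simp add: power_add)
  also have "1 + (d - 1) = d" using d_pos by simp
  finally have "d dvd 1 + e * k" by (simp only: root_power root_power_eq_1_iff)
  then show ?thesis unfolding b_def by (rule someI)
qed

definition orb :: "complex \<Rightarrow> complex \<Rightarrow> (complex \<times> complex) set" where
  "orb x y = group_orbit (cyclic_action \<zeta> e) (x, y)"

lemma orb_eq: "orb x y = {(\<zeta> ^ k * x, \<zeta> ^ (e * k) * y) | k. True}"
  by (auto simp: orb_def group_orbit_def cyclic_action_def power_mult mult.commute[of e] image_iff)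

lemma root_power_add_inverse: "\<zeta> ^ (j * k) * \<zeta> ^ (j * (k * (d - 1))) = 1"
proof -
  have "j * k + j * (k * (d - 1)) = d * (j * k)" using d_pos by (cases d) (auto simp: algebra_simps)
  then have "\<zeta> ^ (j * k + j * (k * (d - 1))) = 1" by (simp only: root_power_eq_1_iff dvd_triv_left)
  then show ?thesis by (simp only: power_add)
qed

lemma orb_self: "(x, y) \<in> orb x y"
  unfolding orb_eq by (intro CollectI exI[of _ 0]) simp

lemma orb_eq_iff: "orb x y = orb x' y' \<longleftrightarrow> (\<exists>k. x' = \<zeta> ^ k * x \<and> y' = \<zeta> ^ (e * k) * y)"
proof
  assume "orb x y = orb x' y'"
  with orb_self[of x' y'] have "(x', y') \<in> orb x y" by simp
  then show "\<exists>k. x' = \<zeta> ^ k * x \<and> y' = \<zeta> ^ (e * k) * y" by (auto simp: orb_eq)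
next
  have sub: "orb (\<zeta> ^ k * x) (\<zeta> ^ (e * k) * y) \<subseteq> orb x y" for x y k
  proof
    fix P assume "P \<in> orb (\<zeta> ^ k * x) (\<zeta> ^ (e * k) * y)"
    then obtain j where "P = (\<zeta> ^ j * (\<zeta> ^ k * x), \<zeta> ^ (e * j) * (\<zeta> ^ (e * k) * y))"
      by (auto simp: orb_eq)
    then have "P = (\<zeta> ^ (j + k) * x, \<zeta> ^ (e * (j + k)) * y)"
      by (simp add: power_add algebra_simps)
    then show "P \<in> orb x y" unfolding orb_eq by blast
  qed
  assume "\<exists>k. x' = \<zeta> ^ k * x \<and> y' = \<zeta> ^ (e * k) * y"
  then obtain k where k: "x' = \<zeta> ^ k * x" "y' = \<zeta> ^ (e * k) * y" by blast
  have "\<zeta> ^ (k * (d - 1)) * x' = (\<zeta> ^ (1 * k) * \<zeta> ^ (1 * (k * (d - 1)))) * x"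
    by (simp only: k mult_1_left ac_simps)
  then have 1: "\<zeta> ^ (k * (d - 1)) * x' = x" unfolding root_power_add_inverse by (simp only: mult_1_left)
  have "\<zeta> ^ (e * (k * (d - 1))) * y' = (\<zeta> ^ (e * k) * \<zeta> ^ (e * (k * (d - 1)))) * y"
    by (simp only: k mult.assoc mult.left_commute)
  then have 2: "\<zeta> ^ (e * (k * (d - 1))) * y' = y" by (simp only: root_power_add_inverse mult_1_left)
  from sub[of k x y] sub[of "k * (d - 1)" x' y', unfolded 1 2] show "orb x y = orb x' y'" by (auto simp: k)
qed

lemma orb_shift [simp]: "orb (\<zeta> ^ k * x) (\<zeta> ^ (e * k) * y) = orb x y"
  using orb_eq_iff by metis

text \<open>
  The invariants \<open>x\<^sup>d\<close>, \<open>y\<^sup>d\<close> and \<open>x y\<^sup>b\<close> separate orbits: \<open>y\<^sup>d\<close> fixes \<open>y\<close> up to the action, and then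
  \<open>x y\<^sup>b\<close> determines \<open>x\<close> if \<open>y \<noteq> 0\<close>, while \<open>x\<^sup>d\<close> suffices if \<open>y = 0\<close>.
\<close>

lemma orb_eqI:
  assumes x: "x ^ d = x' ^ d" and y: "y ^ d = y' ^ d" and xy: "x * y ^ b = x' * y' ^ b"
  shows "orb x y = orb x' y'"
proof (cases "y = 0")
  case True
  with y d_pos have "y' = 0" by (simp add: power_0_left)
  obtain k where "x' = \<zeta> ^ k * x" using equal_powers[of x' x] x by auto
  then show ?thesis using True \<open>y' = 0\<close> by (auto simp: orb_eq_iff)
next
  case False
  obtain j where j: "y' = \<zeta> ^ j * y" using equal_powers[of y' y] y by auto
  obtain k where ek: "\<zeta> ^ (e * k) = \<zeta> ^ j" using root_e_surjective by blast
  have "\<zeta> ^ (k * (1 + e * b)) = 1" unfolding root_power_eq_1_iff using b by (rule dvd_mult)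
  then have "\<zeta> ^ k * (\<zeta> ^ (e * k)) ^ b = 1" by (simp add: power_mult[symmetric] power_add[symmetric] algebra_simps)
  then have 1: "\<zeta> ^ k * (\<zeta> ^ j) ^ b = 1" by (simp add: ek)
  have "x * y ^ b = (x' * (\<zeta> ^ j) ^ b) * y ^ b" using xy by (simp add: j power_mult_distrib)
  then have "x = x' * (\<zeta> ^ j) ^ b" using False by simp
  then have "\<zeta> ^ k * x = x' * (\<zeta> ^ k * (\<zeta> ^ j) ^ b)" by (simp only: ac_simps)
  then have "x' = \<zeta> ^ k * x" by (simp add: 1)
  with j ek show ?thesis unfolding orb_eq_iff by metis
qed

abbreviation V :: "(complex \<times> complex) set variety" where "V \<equiv> toric_surface \<zeta> e"

lemma points_V: "points V = {orb x y | x y. True}"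
  by (auto simp: toric_surface_def quotient_variety_def affine_plane_def orb_def)

lemma orb_in_V [simp]: "orb x y \<in> points V"
  by (auto simp: points_V)

lemma points_V_E:
  assumes "P \<in> points V"
  obtains x y where "P = orb x y"
  using assms by (auto simp: points_V)

definition invariant :: "bipoly \<Rightarrow> bool" where
  "invariant h \<longleftrightarrow> (\<forall>x y. ev h (\<zeta> * x) (\<zeta> ^ e * y) = ev h x y)"

lemma invariant_power:
  assumes "invariant h"
  shows "ev h (\<zeta> ^ k * x) (\<zeta> ^ (e * k) * y) = ev h x y"
proof (induction k)
  case (Suc k)
  have "ev h (\<zeta> ^ Suc k * x) (\<zeta> ^ (e * Suc k) * y) = ev h (\<zeta> * (\<zeta> ^ k * x)) (\<zeta> ^ e * (\<zeta> ^ (e * k) * y))"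
    by (simp add: power_add mult.assoc)
  also have "\<dots> = ev h x y" using assms Suc.IH by (simp add: invariant_def)
  finally show ?case .
qed simp

lemma invariant_orb: "invariant h \<Longrightarrow> orb x y = orb x' y' \<Longrightarrow> ev h x y = ev h x' y'"
  by (auto simp: orb_eq_iff invariant_power)

text \<open>
  For an invariant polynomial the choice of the representative does not matter.
\<close>

definition descend :: "bipoly \<Rightarrow> (complex \<times> complex) set \<Rightarrow> complex" where
  "descend h = (\<lambda>P\<in>points V. case (SOME p. p \<in> P) of (x, y) \<Rightarrow> ev h x y)"

lemma descend_orb [simp]:
  assumes "invariant h"
  shows "descend h (orb x y) = ev h x y"
proof -
  obtain x' y' where xy: "(SOME p. p \<in> orb x y) = (x', y')" by (cases "SOME p. p \<in> orb x y") auto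
  have "(x', y') \<in> orb x y" unfolding xy[symmetric] using orb_self by (rule someI)
  then obtain k where "x' = \<zeta> ^ k * x" "y' = \<zeta> ^ (e * k) * y" by (auto simp: orb_eq)
  moreover have "descend h (orb x y) = ev h x' y'" by (simp add: descend_def xy)
  ultimately show ?thesis using assms by (simp add: invariant_power)
qed

lemma regular_V: "\<rho> \<in> regular V \<longleftrightarrow> (\<exists>h. invariant h \<and> \<rho> = descend h)"
proof
  assume \<rho>: "\<rho> \<in> regular V"
  then obtain h :: bipoly where "(\<lambda>p. \<rho> (group_orbit (cyclic_action \<zeta> e) p)) = (\<lambda>(x, y). poly (poly h [:y:]) x)"
    by (auto simp: toric_surface_def quotient_variety_def affine_plane_def restrict_UNIV)
  then have h: "\<rho> (orb x y) = ev h x y" for x y by (auto simp: orb_def ev_def fun_eq_iff)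
  have "invariant h" using orb_shift[of 1] by (auto simp: invariant_def h[symmetric])
  moreover have "\<rho> = descend h"
  proof
    fix P show "\<rho> P = descend h P"
    proof (cases "P \<in> points V")
      case True
      then show ?thesis using \<open>invariant h\<close> by (auto simp: points_V h)
    next
      case False
      then show ?thesis using \<rho>
        by (simp add: descend_def) (auto simp: toric_surface_def quotient_variety_def extensional_def)
    qed
  qed
  ultimately show "\<exists>h. invariant h \<and> \<rho> = descend h" by blast
next
  assume "\<exists>h. invariant h \<and> \<rho> = descend h"
  then obtain h where h: "invariant h" "\<rho> = descend h" by blast
  have "(\<lambda>p. descend h (group_orbit (cyclic_action \<zeta> e) p)) = (\<lambda>(x, y). poly (poly h [:y:]) x)"
    using descend_orb[OF h(1)] by (auto simp: orb_def ev_def fun_eq_iff)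
  moreover have "descend h \<in> extensional (points V)" by (simp add: descend_def)
  ultimately show "\<rho> \<in> regular V"
    unfolding h by (auto simp: toric_surface_def quotient_variety_def affine_plane_def restrict_UNIV)
qed

lemma descend_in_regular: "invariant h \<Longrightarrow> descend h \<in> regular V"
  by (auto simp: regular_V)

lemma invariant_monomial: "d dvd i + e * j \<Longrightarrow> invariant (X_var ^ i * Y_var ^ j)"
proof -
  assume "d dvd i + e * j"
  then have "\<zeta> ^ i * (\<zeta> ^ e) ^ j = 1" by (simp add: root_power_eq_1_iff flip: power_mult power_add)
  then show ?thesis unfolding invariant_def by (simp add: power_mult_distrib algebra_simps)
qed

lemma invariant_generators:
  "invariant (X_var ^ d * Y_var ^ 0)" "invariant (X_var ^ 0 * Y_var ^ d)"
  "invariant (X_var ^ 1 * Y_var ^ b)" "invariant (X_var ^ ((d - 1) * e) * Y_var ^ 1)"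
proof -
  have "(d - 1) * e + e * 1 = d * e" using d_pos by (cases d) auto
  then have "d dvd (d - 1) * e + e * 1" by simp
  then show "invariant (X_var ^ ((d - 1) * e) * Y_var ^ 1)" by (rule invariant_monomial)
  show "invariant (X_var ^ 1 * Y_var ^ b)" using b by (rule invariant_monomial)
qed (intro invariant_monomial, simp)+

section \<open>Fibres that are lines\<close>

text \<open>
  The curve \<open>(p, q)\<close> maps onto the fibre of \<open>f\<close> over \<open>t\<close> in the quotient, and the invariant polynomial
  \<open>S\<close> restricts to the inverse of this parametrization.
\<close>

definition param_fibre :: "bipoly \<Rightarrow> complex \<Rightarrow> complex poly \<Rightarrow> complex poly \<Rightarrow> bipoly \<Rightarrow> bool" where
  "param_fibre f t p q S \<longleftrightarrow> invariant S \<and> (\<forall>s. ev S (poly p s) (poly q s) = s) \<and>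
     (\<forall>x y. ev f x y = t \<longleftrightarrow> (\<exists>s. orb x y = orb (poly p s) (poly q s)))"

text \<open>
  Pulling \<open>x\<^sup>d\<close>, \<open>y\<^sup>d\<close>, \<open>x y\<^sup>b\<close> and \<open>x\<^sup>a y\<close> with \<open>a = (d - 1) e\<close> back to the line gives polynomials in
  one variable.  The first two have no common zero, since the fibre avoids the origin, and each
  becomes a \<open>d\<close>-th power after multiplication by a power of the other; hence each is a \<open>d\<close>-th
  power.  Their \<open>d\<close>-th roots are the components of the lifted curve, once the root of unity left
  open by the choice of roots is fixed by means of \<open>x y\<^sup>b\<close>.
\<close>

lemma line_fibre_parametrized:
  assumes f: "invariant f" and t: "t \<noteq> ev f 0 0"
    and iso: "isomorphic (fibre V (descend f) t) affine_line"
  shows "\<exists>p q S. param_fibre f t p q S"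
proof -
  define F where "F = {P \<in> points V. descend f P = t}"
  obtain u \<psi> where u: "morphism (fibre V (descend f) t) affine_line u"
    and \<psi>: "morphism affine_line (fibre V (descend f) t) \<psi>"
    and u\<psi>: "\<And>P. P \<in> F \<Longrightarrow> \<psi> (u P) = P" "\<And>s. u (\<psi> s) = s"
    using iso unfolding isomorphic_def isomorphism_def fibre_points F_def[symmetric] by auto
  have \<psi>F: "\<psi> s \<in> F" for s
    using \<psi> by (auto simp: morphism_def fibre_points F_def)
  have pull: "\<exists>P. \<forall>s. poly P s = descend h (\<psi> s)" if "invariant h" for h
  proof -
    have "compose UNIV (restrict (descend h) F) \<psi> \<in> range poly"
      using \<psi> descend_in_regular[OF that] unfolding morphism_def fibre_regular F_def[symmetric] by auto
    then obtain P where "compose UNIV (restrict (descend h) F) \<psi> = poly P" by auto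
    then have "poly P s = descend h (\<psi> s)" for s
      using \<psi>F[of s] by (metis UNIV_I compose_eq restrict_apply')
    then show ?thesis by blast
  qed
  have "compose F (poly [:0, 1:]) u \<in> regular (fibre V (descend f) t)"
    using u unfolding morphism_def fibre_points F_def[symmetric] by simp
  then obtain \<rho> where "\<rho> \<in> regular V" "compose F (poly [:0, 1:]) u = restrict \<rho> F"
    unfolding fibre_regular F_def[symmetric] by auto
  then obtain S where S: "invariant S" "compose F (poly [:0, 1:]) u = restrict (descend S) F"
    by (auto simp: regular_V)
  have Su: "descend S P = u P" if "P \<in> F" for P
    using fun_cong[OF S(2), of P] that by (simp add: compose_def)
  note inv = invariant_generators
  obtain PX PY PU PW where
      PX: "\<And>s. poly PX s = descend (X_var ^ d * Y_var ^ 0) (\<psi> s)"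
    and PY: "\<And>s. poly PY s = descend (X_var ^ 0 * Y_var ^ d) (\<psi> s)"
    and PU: "\<And>s. poly PU s = descend (X_var ^ 1 * Y_var ^ b) (\<psi> s)"
    and PW: "\<And>s. poly PW s = descend (X_var ^ ((d - 1) * e) * Y_var ^ 1) (\<psi> s)"
    using inv[THEN pull] by metis
  have vals: "\<exists>x y. \<psi> s = orb x y \<and> ev f x y = t \<and> poly PX s = x ^ d \<and> poly PY s = y ^ d \<and>
      poly PU s = x * y ^ b \<and> poly PW s = x ^ ((d - 1) * e) * y" for s
  proof -
    obtain x y where xy: "\<psi> s = orb x y" using \<psi>F[of s] by (auto simp: F_def points_V)
    have "ev f x y = t" using \<psi>F[of s] f by (simp add: F_def xy)
    then show ?thesis using xy inv by (auto simp: PX PY PU PW)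
  qed
  have no: "\<not> (poly PX s = 0 \<and> poly PY s = 0)" for s
    using vals[of s] t d_pos by auto
  have "poly (PX * PY ^ b) s = poly (PU ^ d) s" for s
    using vals[of s] by (auto simp: power_mult_distrib mult.commute[of b] simp flip: power_mult)
  then have XYU: "PX * PY ^ b = PU ^ d" by (simp add: poly_eq_poly_eq_iff[symmetric] fun_eq_iff)
  have "poly (PY * PX ^ ((d - 1) * e)) s = poly (PW ^ d) s" for s
    using vals[of s] by (auto simp: power_mult_distrib ac_simps simp flip: power_mult)
  then have XYW: "PY * PX ^ ((d - 1) * e) = PW ^ d" by (simp add: poly_eq_poly_eq_iff[symmetric] fun_eq_iff)
  obtain p where p: "PX = p ^ d"
    using coprime_factor_of_power[OF d_pos XYU] no by (metis poly_power power_eq_0_iff)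
  obtain q where q: "PY = q ^ d"
    using coprime_factor_of_power[OF d_pos XYW] no by (metis poly_power power_eq_0_iff)
  have "PU ^ d = (p * q ^ b) ^ d"
    unfolding XYU[symmetric] p q by (simp add: power_mult_distrib mult.commute flip: power_mult)
  then obtain k where k: "PU = smult (\<zeta> ^ k) (p * q ^ b)" using equal_polynomial_powers by blast
  define p' where "p' = smult (\<zeta> ^ k) p"
  have p': "PX = p' ^ d" "PU = p' * q ^ b"
    unfolding p'_def p k by (simp_all add: smult_power root_power_eq_1_iff[THEN iffD2] flip: power_mult)
  have \<psi>_eq: "\<psi> s = orb (poly p' s) (poly q s)" for s
  proof -
    obtain x y where xy: "\<psi> s = orb x y" "poly PX s = x ^ d" "poly PY s = y ^ d" "poly PU s = x * y ^ b"
      using vals[of s] by blast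
    have "orb x y = orb (poly p' s) (poly q s)"
      using xy by (intro orb_eqI) (simp_all add: p' q)
    with xy(1) show ?thesis by simp
  qed
  have "param_fibre f t p' q S"
    unfolding param_fibre_def
  proof (intro conjI allI S(1))
    fix s
    have "ev S (poly p' s) (poly q s) = descend S (\<psi> s)" using S(1) by (simp add: \<psi>_eq)
    also have "\<dots> = s" using Su[OF \<psi>F] u\<psi>(2) by simp
    finally show "ev S (poly p' s) (poly q s) = s" .
  next
    fix x y
    have "ev f x y = t \<longleftrightarrow> orb x y \<in> F" using f by (simp add: F_def)
    also have "\<dots> \<longleftrightarrow> (\<exists>s. orb x y = \<psi> s)" using u\<psi>(1) \<psi>F by metis
    finally show "ev f x y = t \<longleftrightarrow> (\<exists>s. orb x y = orb (poly p' s) (poly q s))" by (simp add: \<psi>_eq)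
  qed
  then show ?thesis by blast
qed

lemma parametrized_fibre_is_line:
  assumes f: "invariant f" and par: "param_fibre f t p q S"
  shows "isomorphic (fibre V (descend f) t) affine_line"
proof -
  define F where "F = {P \<in> points V. descend f P = t}"
  have S: "invariant S" "\<And>s. ev S (poly p s) (poly q s) = s"
    and F_iff: "\<And>x y. ev f x y = t \<longleftrightarrow> (\<exists>s. orb x y = orb (poly p s) (poly q s))"
    using par by (auto simp: param_fibre_def)
  define \<psi> where "\<psi> s = orb (poly p s) (poly q s)" for s
  have \<psi>F: "\<psi> s \<in> F" for s using F_iff[of "poly p s" "poly q s"] f by (auto simp: F_def \<psi>_def)
  have F_E: "\<exists>s. P = \<psi> s" if PF: "P \<in> F" for P
  proof -
    obtain x y where "P = orb x y" using PF unfolding F_def by (blast elim: points_V_E)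
    with PF f F_iff[of x y] show ?thesis by (simp add: F_def \<psi>_def)
  qed
  let ?u = "restrict (descend S) F"
  have u\<psi>: "?u (\<psi> s) = s" for s using S \<psi>F[of s] by simp (simp add: \<psi>_def)
  have "morphism (fibre V (descend f) t) affine_line ?u"
    unfolding morphism_def fibre_points fibre_regular F_def[symmetric]
  proof (intro conjI ballI)
    show "?u \<in> F \<rightarrow>\<^sub>E points affine_line" by auto
    fix g assume "g \<in> regular affine_line"
    then obtain G where G: "g = poly G" by auto
    have "invariant (subst1 G S)" using S(1) by (simp add: invariant_def)
    moreover have "compose F g ?u = restrict (descend (subst1 G S)) F"
    proof
      fix P show "compose F g ?u P = restrict (descend (subst1 G S)) F P"
        using \<open>invariant (subst1 G S)\<close> S(1) by (auto simp: compose_def G F_def points_V)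
    qed
    ultimately show "compose F g ?u \<in> (\<lambda>f. restrict f F) ` regular V"
      using descend_in_regular by blast
  qed
  moreover have "morphism affine_line (fibre V (descend f) t) \<psi>"
    unfolding morphism_def fibre_points fibre_regular F_def[symmetric]
  proof (intro conjI ballI)
    show "\<psi> \<in> points affine_line \<rightarrow>\<^sub>E F" using \<psi>F by auto
    fix g assume "g \<in> (\<lambda>f. restrict f F) ` regular V"
    then obtain h where h: "invariant h" "g = restrict (descend h) F" by (auto simp: regular_V)
    have "compose UNIV g \<psi> = poly (along h p q)"
    proof
      fix s show "compose UNIV g \<psi> s = poly (along h p q) s"
        using \<psi>F[of s] h by (simp add: compose_def) (simp add: \<psi>_def)
    qed
    then show "compose (points affine_line) g \<psi> \<in> regular affine_line" by simp
  qed
  moreover have "\<psi> (?u P) = P" if "P \<in> F" for P using F_E[OF that] u\<psi> by metis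
  ultimately show ?thesis
    unfolding isomorphic_def isomorphism_def fibre_points F_def[symmetric]
    using u\<psi> by (intro exI[of _ ?u] conjI exI[of _ \<psi>] ballI) auto
qed

end

section \<open>The Jacobian derivation of a fibration\<close>

lemma higher_pderiv_eq_0: "degree p < n \<Longrightarrow> (pderiv ^^ n) (p :: complex poly) = 0"
proof (induction n arbitrary: p)
  case (Suc n)
  show ?case
  proof (cases "n = 0")
    case True
    with Suc.prems show ?thesis by (simp add: pderiv_eq_0_iff)
  next
    case False
    with Suc.prems have "degree (pderiv p) < n" by (simp add: degree_pderiv)
    from Suc.IH[OF this] show ?thesis by (simp add: funpow_swap1)
  qed
qed simp

text \<open>
  Shifting the index is how the generator of the group acts on norms and averages over the group.
\<close>

lemma prod_cyclic_shift:
  fixes F :: "nat \<Rightarrow> 'a :: comm_monoid_mult"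
  assumes "d > 0" "F d = F 0"
  shows "(\<Prod>k<d. F (Suc k)) = (\<Prod>k<d. F k)"
proof -
  obtain n where n: "d = Suc n" using assms(1) gr0_implies_Suc by blast
  have "(\<Prod>k<d. F k) = F 0 * (\<Prod>k<n. F (Suc k))" unfolding n by (rule prod.lessThan_Suc_shift)
  then show ?thesis using assms(2) by (simp add: n mult.commute)
qed

lemma sum_cyclic_shift:
  fixes F :: "nat \<Rightarrow> 'a :: comm_monoid_add"
  assumes "d > 0" "F d = F 0"
  shows "(\<Sum>k<d. F (Suc k)) = (\<Sum>k<d. F k)"
proof -
  obtain n where n: "d = Suc n" using assms(1) gr0_implies_Suc by blast
  have "(\<Sum>k<d. F k) = F 0 + (\<Sum>k<n. F (Suc k))" unfolding n by (rule sum.lessThan_Suc_shift)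
  then show ?thesis using assms(2) by (simp add: n add.commute)
qed

context cyclic_quotient
begin

text \<open>
  Pullback along the \<open>k\<close>-th power of the generator of the group.
\<close>

definition act :: "nat \<Rightarrow> bipoly \<Rightarrow> bipoly" where
  "act k h = subst h (const (\<zeta> ^ k) * X_var) (const (\<zeta> ^ (e * k)) * Y_var)"

lemma ev_act [simp]: "ev (act k h) x y = ev h (\<zeta> ^ k * x) (\<zeta> ^ (e * k) * y)"
  by (simp add: act_def)

lemma act_invariant: "invariant f \<Longrightarrow> act k f = f"
  by (rule ev_eqI) (simp add: invariant_power)

lemma invariant_iff_act: "invariant h \<longleftrightarrow> act 1 h = h"
proof
  assume "act 1 h = h"
  then have "ev (act 1 h) x y = ev h x y" for x y by simp
  then show "invariant h" by (simp add: invariant_def)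
qed (rule act_invariant)

lemma act_mult [simp]: "act k (u * v) = act k u * act k v"
  and act_diff [simp]: "act k (u - v) = act k u - act k v"
  and act_const [simp]: "act k (const c) = const c"
  and act_0 [simp]: "act 0 u = u"
  and act_zero [simp]: "act k 0 = 0"
  by (rule ev_eqI; simp)+

lemma act_Suc: "act (Suc k) u = act 1 (act k u)"
  by (rule ev_eqI) (simp add: power_add mult.assoc mult.left_commute)

lemma root_e_power [simp]: "\<zeta> ^ (e * d) = 1"
  by (simp add: root_power_eq_1_iff)

lemma act_d [simp]: "act d u = u"
  by (rule ev_eqI) simp

lemma dx_act: "dx (act k h) = const (\<zeta> ^ k) * act k (dx h)"
  and dy_act: "dy (act k h) = const (\<zeta> ^ (e * k)) * act k (dy h)"
  by (simp_all add: act_def dx_subst dy_subst)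

lemma jac_act: "jac (act k u) (act k v) = const (\<zeta> ^ (k + e * k)) * act k (jac u v)"
  by (rule ev_eqI) (simp add: jac_def dx_act dy_act power_add algebra_simps)

lemma orb_eq_shift:
  assumes "orb x y = orb x' y'"
  shows "\<exists>k<d. x = \<zeta> ^ k * x' \<and> y = \<zeta> ^ (e * k) * y'"
proof -
  obtain k where "x = \<zeta> ^ k * x'" "y = \<zeta> ^ (e * k) * y'" using assms orb_eq_iff by metis
  moreover have "\<zeta> ^ k = \<zeta> ^ (k mod d)" by (simp add: root_power_eq_iff cong_def)
  moreover have "\<zeta> ^ (e * k) = \<zeta> ^ (e * (k mod d))"
    by (simp add: root_power_eq_iff cong_def mod_mult_right_eq)
  moreover have "k mod d < d" using d_pos by simp
  ultimately show ?thesis by metis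
qed

lemma param_fibre_iff:
  "param_fibre f t p q S \<Longrightarrow> ev f x y = t \<longleftrightarrow> (\<exists>s. orb x y = orb (poly p s) (poly q s))"
  by (simp add: param_fibre_def)

lemma param_fibre_point: "param_fibre f t p q S \<Longrightarrow> ev f (poly p s) (poly q s) = t"
  unfolding param_fibre_iff by (rule exI) (rule refl)

lemma param_fibre_shift:
  assumes "param_fibre f t p q S"
  shows "param_fibre f t (smult (\<zeta> ^ k) p) (smult (\<zeta> ^ (e * k)) q) S"
  using assms by (simp add: param_fibre_def invariant_power)

text \<open>
  The factor \<open>l\<close> is the restriction of \<open>jac f S\<close> to the line, so it has to be shown that this
  polynomial has no zero.  Modulo \<open>f - t\<close> every invariant polynomial is a polynomial in \<open>S\<close>.
  Therefore, at a point of the fibre where \<open>jac f S\<close> vanishes, the Jacobian of any two invariants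
  vanishes too.  But \<open>x y\<^sup>b, y\<^sup>d\<close> have independent differentials where \<open>y \<noteq> 0\<close>, and so do \<open>x\<^sup>d, x\<^sup>a y\<close>
  with \<open>a = (d - 1) e\<close> where \<open>x \<noteq> 0\<close> and \<open>y = 0\<close>.  Since \<open>f\<close> is constant on the line and \<open>S\<close>
  restricts to the parameter, the formula for general \<open>h\<close> is then linear algebra.
\<close>

lemma jac_along_line:
  assumes f: "invariant f" and t: "t \<noteq> ev f 0 0" and sq: "squarefree (f - const t)"
    and par: "param_fibre f t p q S"
  shows "\<exists>l. l \<noteq> 0 \<and> (\<forall>h. along (jac f h) p q = smult l (pderiv (along h p q)))"
proof -
  have S: "invariant S" "\<And>s. ev S (poly p s) (poly q s) = s"
    using par by (simp_all add: param_fibre_def)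
  note F = param_fibre_iff[OF par] and on = param_fibre_point[OF par]
  have relation: "\<exists>w. h = subst1 (along h p q) S + (f - const t) * w" if h: "invariant h" for h
  proof -
    have "ev (h - subst1 (along h p q) S) x y = 0" if "ev (f - const t) x y = 0" for x y
    proof -
      have "ev f x y = t" using that by simp
      then obtain s where s: "orb x y = orb (poly p s) (poly q s)" unfolding F by blast
      then show ?thesis
        using invariant_orb[OF h s] invariant_orb[OF S(1) s] S(2)[of s] by simp
    qed
    then have "f - const t dvd h - subst1 (along h p q) S"
      by (rule squarefree_curve_nullstellensatz[OF sq])
    then obtain w where "h - subst1 (along h p q) S = (f - const t) * w" by (elim dvdE)
    then show ?thesis by (metis add.commute diff_add_cancel)
  qed
  have singular: "ev (jac h1 h2) x y = 0"
    if inv: "invariant h1" "invariant h2" and xy: "ev f x y = t" "ev (jac f S) x y = 0" for h1 h2 x y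
  proof -
    obtain w1 w2 where w: "h1 = subst1 (along h1 p q) S + (f - const t) * w1"
      "h2 = subst1 (along h2 p q) S + (f - const t) * w2"
      using relation inv by metis
    have J: "ev (dx f) x y * ev (dy S) x y = ev (dy f) x y * ev (dx S) x y"
      using xy(2) by (simp add: jac_def)
    define A B where "A = poly (pderiv (along h1 p q)) (ev S x y)"
      and "B = poly (pderiv (along h2 p q)) (ev S x y)"
    have "ev (dx h1) x y = A * ev (dx S) x y + ev (dx f) x y * ev w1 x y"
      "ev (dy h1) x y = A * ev (dy S) x y + ev (dy f) x y * ev w1 x y"
      unfolding A_def by (subst w(1), simp add: dx_subst1 dy_subst1 xy)+
    moreover have "ev (dx h2) x y = B * ev (dx S) x y + ev (dx f) x y * ev w2 x y"
      "ev (dy h2) x y = B * ev (dy S) x y + ev (dy f) x y * ev w2 x y"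
      unfolding B_def by (subst w(2), simp add: dx_subst1 dy_subst1 xy)+
    ultimately show ?thesis
      unfolding jac_def ev_simps using J by algebra
  qed
  have nonzero: "ev (jac f S) x y \<noteq> 0" if xy: "ev f x y = t" for x y
  proof
    assume z: "ev (jac f S) x y = 0"
    show False
    proof (cases "y = 0")
      case False
      from singular[OF invariant_generators(3,2) xy z] show False
        using False d_pos by (simp add: jac_def ev_power_derivatives)
    next
      case True
      then have "x \<noteq> 0" using xy t by auto
      from singular[OF invariant_generators(1,4) xy z] show False
        using \<open>x \<noteq> 0\<close> d_pos by (simp add: jac_def ev_power_derivatives)
    qed
  qed
  have "degree (along (jac f S) p q) = 0"
  proof (rule ccontr)
    assume "degree (along (jac f S) p q) \<noteq> 0"
    then obtain s where "poly (along (jac f S) p q) s = 0" using complex_root_exists by blast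
    then show False using nonzero[OF on] by simp
  qed
  then obtain l where l: "along (jac f S) p q = [:l:]" by (rule degree_eq_zeroE)
  have l_eq: "ev (jac f S) (poly p s) (poly q s) = l" for s
    unfolding poly_along[symmetric] l by simp
  have "l \<noteq> 0" using nonzero[OF on] l_eq by metis
  moreover have "along (jac f h) p q = smult l (pderiv (along h p q))" for h
  proof -
    have "poly (along (jac f h) p q) s = poly (smult l (pderiv (along h p q))) s" for s
    proof -
      have "along S p q = [:0, 1:]"
        using S(2) by (simp add: poly_eq_poly_eq_iff[symmetric] fun_eq_iff)
      then have 1: "ev (dx S) (poly p s) (poly q s) * poly (pderiv p) s
          + ev (dy S) (poly p s) (poly q s) * poly (pderiv q) s = 1"
        using poly_pderiv_along[of S p q s] by (simp add: pderiv_pCons)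
      have "along f p q = [:t:]"
        using on by (simp add: poly_eq_poly_eq_iff[symmetric] fun_eq_iff)
      then have 2: "ev (dx f) (poly p s) (poly q s) * poly (pderiv p) s
          + ev (dy f) (poly p s) (poly q s) * poly (pderiv q) s = 0"
        using poly_pderiv_along[of f p q s] by simp
      show ?thesis
        using 1 2 l_eq[of s] unfolding poly_smult poly_pderiv_along poly_along jac_def ev_simps by algebra
    qed
    then show ?thesis by (simp add: poly_eq_poly_eq_iff[symmetric] fun_eq_iff)
  qed
  ultimately show ?thesis by blast
qed

end

text \<open>
  The data that a fibration provides after finitely many fibres have been discarded.
\<close>

locale line_fibration = cyclic_quotient +
  fixes f :: bipoly and T :: "complex set" and p q :: "complex \<Rightarrow> complex poly" and S :: "complex \<Rightarrow> bipoly"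
  assumes f_inv: "invariant f" and nonconst: "\<And>c. f \<noteq> const c" and cofinite: "finite (- T)"
    and reduced: "\<And>t. t \<in> T \<Longrightarrow> squarefree (f - const t)"
    and no_origin: "\<And>t. t \<in> T \<Longrightarrow> t \<noteq> ev f 0 0"
    and lines: "\<And>t. t \<in> T \<Longrightarrow> param_fibre f t (p t) (q t) (S t)"
begin

definition line_x :: "complex \<Rightarrow> nat \<Rightarrow> complex poly" where "line_x t k = smult (\<zeta> ^ k) (p t)"
definition line_y :: "complex \<Rightarrow> nat \<Rightarrow> complex poly" where "line_y t k = smult (\<zeta> ^ (e * k)) (q t)"

lemma jac_along_lines:
  assumes "t \<in> T"
  obtains l where "l \<noteq> 0" "\<And>h. along (jac f h) (line_x t k) (line_y t k) = smult l (pderiv (along h (line_x t k) (line_y t k)))"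
proof -
  obtain l where "l \<noteq> 0 \<and> (\<forall>h. along (jac f h) (line_x t k) (line_y t k) = smult l (pderiv (along h (line_x t k) (line_y t k))))"
    using jac_along_line[OF f_inv no_origin[OF assms] reduced[OF assms]
        param_fibre_shift[OF lines[OF assms], of k], folded line_x_def line_y_def] by (rule exE)
  then show ?thesis using that[of l] by simp
qed

lemma line_in_fibre: "t \<in> T \<Longrightarrow> ev f (poly (line_x t k) s) (poly (line_y t k) s) = t"
  unfolding line_x_def line_y_def by (rule param_fibre_point[OF param_fibre_shift[OF lines]])

lemma fibre_point_on_line:
  assumes "t \<in> T" "ev f x y = t"
  obtains k s where "k < d" "x = poly (line_x t k) s" "y = poly (line_y t k) s"
proof -
  obtain s where "orb x y = orb (poly (p t) s) (poly (q t) s)"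
    using assms(2) unfolding param_fibre_iff[OF lines[OF assms(1)]] by blast
  from orb_eq_shift[OF this] obtain k where
    "k < d" "x = \<zeta> ^ k * poly (p t) s" "y = \<zeta> ^ (e * k) * poly (q t) s" by blast
  then show ?thesis by (intro that[of k s]) (simp_all add: line_x_def line_y_def)
qed

text \<open>
  This reduces identities in \<open>B\<close> to identities between polynomials in the parameters of the lines.
\<close>

lemma vanishing_on_lines:
  assumes "infinite T'" "T' \<subseteq> T" "\<And>t k. t \<in> T' \<Longrightarrow> k < d \<Longrightarrow> along h (line_x t k) (line_y t k) = 0"
  shows "h = 0"
proof (rule vanishing_on_infinitely_many_fibres[OF nonconst assms(1)])
  show "squarefree (f - const t)" if "t \<in> T'" for t using that assms(2) reduced by blast
  fix t x y assume t: "t \<in> T'" "ev f x y = t"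
  then have "t \<in> T" using assms(2) by blast
  from fibre_point_on_line[OF this t(2)] obtain k s where "k < d" "x = poly (line_x t k) s" "y = poly (line_y t k) s" .
  then show "ev h x y = 0" using assms(3)[OF t(1) \<open>k < d\<close>] by (metis poly_0 poly_along)
qed

lemma uncountable_T: "uncountable T"
proof
  assume "countable T"
  then have "countable (T \<union> - T)" using countable_finite[OF cofinite] by (rule countable_Un)
  then show False using uncountable_UNIV_complex by simp
qed

lemma infinite_T: "infinite T"
  using uncountable_T countable_finite by blast

text \<open>
  On a line, \<open>n\<close> applications of \<open>jac f\<close> kill every polynomial whose restriction has degree less
  than \<open>n\<close>.  The degrees depend on \<open>t\<close>, but uncountably many \<open>t\<close> share countably many bounds.
\<close>

lemma jac_locally_nilpotent: "\<exists>n. (jac f ^^ n) h = 0"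
proof -
  define N where "N t = Suc (\<Sum>k<d. degree (along h (line_x t k) (line_y t k)))" for t
  have "\<exists>n. infinite {t \<in> T. N t = n}"
  proof (rule ccontr)
    assume "\<not> ?thesis"
    then have "countable (\<Union>n. {t \<in> T. N t = n})" by (intro countable_UN) (auto simp: countable_finite)
    also have "(\<Union>n. {t \<in> T. N t = n}) = T" by auto
    finally show False using uncountable_T by blast
  qed
  then obtain n where n: "infinite {t \<in> T. N t = n}" by blast
  have "(jac f ^^ n) h = 0"
  proof (rule vanishing_on_lines[OF n])
    fix t k assume tk: "t \<in> {t \<in> T. N t = n}" "k < d"
    then obtain l where l: "\<And>h. along (jac f h) (line_x t k) (line_y t k) = smult l (pderiv (along h (line_x t k) (line_y t k)))"
      using jac_along_lines by blast
    have "along ((jac f ^^ m) h) (line_x t k) (line_y t k) = smult (l ^ m) ((pderiv ^^ m) (along h (line_x t k) (line_y t k)))" for m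
      by (induction m) (simp_all add: l pderiv_smult)
    moreover have "degree (along h (line_x t k) (line_y t k)) < n"
    proof -
      have "degree (along h (line_x t k) (line_y t k)) \<le> (\<Sum>k<d. degree (along h (line_x t k) (line_y t k)))"
        using tk(2) by (intro member_le_sum) auto
      then show ?thesis using tk(1) by (auto simp: N_def)
    qed
    ultimately show "along ((jac f ^^ n) h) (line_x t k) (line_y t k) = 0" by (simp add: higher_pderiv_eq_0)
  qed auto
  then show ?thesis by blast
qed

text \<open>
  A factor of \<open>f - c\<close> has no zero on a line in another fibre, so it is constant there.
\<close>

lemma divisor_in_kernel:
  assumes "u dvd f - const c"
  shows "jac f u = 0"
proof (rule vanishing_on_lines)
  obtain w where w: "f - const c = u * w" using assms by (elim dvdE)
  show "infinite (T - {c})" using infinite_T by simp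
  fix t k assume t: "t \<in> T - {c}"
  then obtain l where l: "\<And>h. along (jac f h) (line_x t k) (line_y t k) = smult l (pderiv (along h (line_x t k) (line_y t k)))"
    using jac_along_lines by blast
  have "degree (along u (line_x t k) (line_y t k)) = 0"
  proof (rule ccontr)
    assume "degree (along u (line_x t k) (line_y t k)) \<noteq> 0"
    then obtain s where s: "poly (along u (line_x t k) (line_y t k)) s = 0" using complex_root_exists by blast
    have "ev (f - const c) (poly (line_x t k) s) (poly (line_y t k) s) = 0"
      unfolding w using s by simp
    then show False using t line_in_fibre[of t k s] by simp
  qed
  then show "along (jac f u) (line_x t k) (line_y t k) = 0" by (simp add: l pderiv_eq_0_iff)
qed auto

text \<open>
  On one fibre \<open>h\<close> is a constant \<open>c\<close>: it is constant on the line, whose translates make up the fibre.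
  Now divide \<open>h - c\<close> by \<open>f - t\<close> and repeat.
\<close>

lemma invariant_kernel:
  assumes "jac f h = 0" "invariant h"
  shows "\<exists>W. h = subst1 W f"
  using assms
proof (induction "mdeg h" arbitrary: h rule: less_induct)
  case less
  obtain t where t: "t \<in> T" using infinite_imp_nonempty[OF infinite_T] by blast
  obtain l where l: "l \<noteq> 0" "\<And>h. along (jac f h) (line_x t 0) (line_y t 0) = smult l (pderiv (along h (line_x t 0) (line_y t 0)))"
    using jac_along_lines[OF t] by blast
  have "along 0 u v = 0" for u v by (simp add: along_def)
  with l(2)[of h] less.prems(1) l(1) have "pderiv (along h (line_x t 0) (line_y t 0)) = 0" by simp
  then obtain c where c: "along h (line_x t 0) (line_y t 0) = [:c:]" by (auto dest: pderiv_iszero)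
  have "f - const t dvd h - const c"
  proof (rule squarefree_curve_nullstellensatz[OF reduced[OF t]])
    fix x y assume "ev (f - const t) x y = 0"
    then have "ev f x y = t" by simp
    then obtain s where s: "orb x y = orb (poly (p t) s) (poly (q t) s)"
      unfolding param_fibre_iff[OF lines[OF t]] by blast
    have "ev h x y = poly (along h (line_x t 0) (line_y t 0)) s"
      using invariant_orb[OF less.prems(2) s] by (simp add: line_x_def line_y_def)
    then show "ev (h - const c) x y = 0" by (simp add: c)
  qed
  then obtain h1 where h1: "h - const c = (f - const t) * h1" by (elim dvdE)
  show ?case
  proof (cases "h - const c = 0")
    case True
    then have "h = subst1 [:c:] f" by simp
    then show ?thesis by blast
  next
    case False
    have nz: "f - const t \<noteq> 0" using nonconst[of t] by simp
    have "mdeg h1 < mdeg h" using mdeg_minus_const_mult[OF nonconst h1 False] .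
    moreover have "jac f h1 = 0"
    proof -
      have "jac f (h - const c) = (f - const t) * jac f h1" unfolding h1 by (simp add: jac_mult)
      then show ?thesis using less.prems(1) nz by simp
    qed
    moreover have "invariant h1"
    proof -
      have "(f - const t) * act 1 h1 = act 1 (h - const c)"
        by (simp only: h1 act_mult act_diff act_const act_invariant[OF f_inv])
      also have "\<dots> = (f - const t) * h1"
        unfolding act_diff act_const act_invariant[OF less.prems(2)] by (rule h1)
      finally have "act 1 h1 = h1" using nz by (simp only: mult_left_cancel simp_thms)
      then show ?thesis by (simp add: invariant_iff_act)
    qed
    ultimately obtain W where "h1 = subst1 W f" using less.hyps by blast
    moreover have "h = const c + (f - const t) * h1" using h1 by (metis add.commute diff_add_cancel)
    ultimately have "h = subst1 ([:c:] + [:- t, 1:] * W) f" by (simp only: subst1_simps subst1_linear)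
    then show ?thesis by blast
  qed
qed

lemma kernel_act:
  assumes "jac f h = 0"
  shows "jac f (act k h) = 0"
proof -
  have "jac f (act k h) = jac (act k f) (act k h)" by (simp only: act_invariant[OF f_inv])
  also have "\<dots> = 0" by (simp only: jac_act assms act_zero mult_zero_right)
  finally show ?thesis .
qed

text \<open>
  For \<open>z = h(x, y)\<close> the norm of \<open>h - z\<close> over the group is a polynomial in \<open>f\<close>.  It vanishes at \<open>(x, y)\<close>,
  hence also at the origin, which lies in the same fibre.  As the origin is fixed by the group,
  the norm there is \<open>(h(0, 0) - z)\<^sup>d\<close>.
\<close>

lemma kernel_constant_on_special_fibre:
  assumes "jac f h = 0" and "ev f x y = ev f 0 0"
  shows "ev h x y = ev h 0 0"
proof -
  define z where "z = ev h x y"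
  define N where "N = (\<Prod>k<d. act k h - const z)"
  have "jac f N = 0"
    unfolding N_def using assms(1) by (intro jac_prod_eq_0) (simp add: kernel_act)
  moreover have "invariant N"
    unfolding invariant_def
  proof (intro allI)
    fix x y
    define F where "F k = ev h (\<zeta> ^ k * x) (\<zeta> ^ (e * k) * y) - z" for k
    have "ev N (\<zeta> * x) (\<zeta> ^ e * y) = (\<Prod>k<d. F (Suc k))"
      by (simp add: N_def F_def power_add mult.assoc mult.left_commute)
    also have "\<dots> = (\<Prod>k<d. F k)" by (rule prod_cyclic_shift[OF d_pos]) (simp add: F_def)
    also have "\<dots> = ev N x y" by (simp add: N_def F_def)
    finally show "ev N (\<zeta> * x) (\<zeta> ^ e * y) = ev N x y" .
  qed
  ultimately obtain W where W: "N = subst1 W f" using invariant_kernel by blast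
  have "ev N x y = 0" using d_pos by (auto simp: N_def z_def intro!: bexI[of _ 0])
  then have "ev N 0 0 = 0" using assms(2) by (simp add: W)
  then show ?thesis by (simp add: N_def z_def)
qed

text \<open>
  Let \<open>g\<close> be a prime factor of \<open>f - f(0, 0)\<close>.  Every \<open>h\<close> in the kernel is constant on the fibre
  through the origin and hence on \<open>g = 0\<close>, so \<open>g\<close> divides \<open>h - h(0, 0)\<close>; the quotient is again in
  the kernel, and the argument repeats.
\<close>

lemma kernel_generator:
  obtains g where "\<And>h. jac f h = 0 \<longleftrightarrow> (\<exists>U. h = subst1 U g)" "\<And>c. g \<noteq> const c"
    "\<And>h. jac f h = 0 \<Longrightarrow> g dvd h - const (ev h 0 0)"
proof -
  define c0 where "c0 = ev f 0 0"
  have "f - const c0 \<noteq> 0" using nonconst[of c0] by simp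
  moreover have "\<not> is_unit (f - const c0)"
    using minus_const_nonconst[OF nonconst] by (auto simp: is_unit_bipoly_iff)
  ultimately obtain g where g: "g dvd f - const c0" "prime g" using prime_divisor_exists by blast
  have kg: "jac f g = 0" using g(1) by (rule divisor_in_kernel)
  have gp: "prime_elem g" using g(2) by (rule prime_imp_prime_elem)
  have dvd: "g dvd h - const (ev h 0 0)" if "jac f h = 0" for h
  proof (rule prime_curve_nullstellensatz[OF gp])
    fix x y assume "ev g x y = 0"
    then have "ev (f - const c0) x y = 0" using g(1) by (elim dvdE) simp
    then show "ev (h - const (ev h 0 0)) x y = 0"
      using kernel_constant_on_special_fibre[OF that, of x y] by (simp add: c0_def)
  qed
  have ncg: "g \<noteq> const c" for c
  proof
    assume "g = const c"
    then show False using gp is_unit_bipoly_iff[of g] by (auto simp: prime_elem_def)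
  qed
  have "\<exists>U. h = subst1 U g" if "jac f h = 0" for h
    using that
  proof (induction "mdeg h" arbitrary: h rule: less_induct)
    case less
    define c where "c = ev h 0 0"
    obtain h1 where h1: "h - const c = g * h1" using dvd[OF less.prems] unfolding c_def by (elim dvdE)
    show ?case
    proof (cases "h - const c = 0")
      case True
      then have "h = subst1 [:c:] g" by simp
      then show ?thesis by blast
    next
      case False
      have "mdeg h1 < mdeg h" using mdeg_minus_const_mult[of g h c 0 h1] ncg h1 False by simp
      moreover have "jac f h1 = 0"
      proof -
        have "jac f (h - const c) = g * jac f h1" unfolding h1 by (simp add: jac_mult kg)
        then show ?thesis using less.prems ncg[of 0] by simp
      qed
      ultimately obtain U where "h1 = subst1 U g" using less.hyps by blast
      moreover have "h = const c + g * h1" using h1 by (metis add.commute diff_add_cancel)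
      ultimately have "h = subst1 ([:c:] + [:0, 1:] * U) g" by (simp only: subst1_simps)
      then show ?thesis by blast
    qed
  qed
  moreover have "jac f h = 0" if "\<exists>U. h = subst1 U g" for h using that kg by auto
  ultimately have "jac f h = 0 \<longleftrightarrow> (\<exists>U. h = subst1 U g)" for h by (rule iffI)
  from this ncg dvd show ?thesis by (rule that)
qed

end

section \<open>Equivariant coordinates\<close>

context line_fibration
begin

text \<open>
  Factors of \<open>g - c\<close> divide \<open>f - R(c)\<close> when \<open>f = R(g)\<close>, so they are polynomials in \<open>g\<close>; but \<open>T - c\<close>
  has no proper factors in \<open>\<complex>[T]\<close>.
\<close>

lemma generator_fibres_prime:
  assumes kernel: "\<And>h. jac f h = 0 \<longleftrightarrow> (\<exists>U. h = subst1 U g)" and ncg: "\<And>c. g \<noteq> const c"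
  shows "prime_elem (g - const c)"
proof (rule irreducible_imp_prime_elem, rule irreducibleI)
  show "g - const c \<noteq> 0" using ncg[of c] by simp
  show "\<not> is_unit (g - const c)"
    using minus_const_nonconst[OF ncg] by (auto simp: is_unit_bipoly_iff)
  have "jac f f = 0" by simp
  then obtain R where R: "f = subst1 R g" using kernel by blast
  fix u v assume uv: "g - const c = u * v"
  obtain R1 where "R = [:- c, 1:] * R1 + [:poly R c:]" using poly_linear_remainder by blast
  then have "f = (g - const c) * subst1 R1 g + const (poly R c)"
    unfolding R by (metis subst1_simps(2,3,4) subst1_linear)
  then have "f - const (poly R c) = (g - const c) * subst1 R1 g" by (simp add: diff_eq_eq)
  then have *: "f - const (poly R c) = u * (v * subst1 R1 g)" "f - const (poly R c) = v * (u * subst1 R1 g)"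
    unfolding uv by (simp_all only: ac_simps)
  have "jac f u = 0" "jac f v = 0"
    by (rule divisor_in_kernel[OF dvdI[OF *(1)]]) (rule divisor_in_kernel[OF dvdI[OF *(2)]])
  then obtain U W where U: "u = subst1 U g" and W: "v = subst1 W g" using kernel by auto
  have "subst1 [:- c, 1:] g = subst1 (U * W) g" using uv by (simp only: subst1_simps subst1_linear U W)
  then have UW: "[:- c, 1:] = U * W" by (rule subst1_inject[OF ncg])
  then have nz: "U \<noteq> 0" "W \<noteq> 0" by auto
  then have "degree U + degree W = 1" using arg_cong[OF UW, of degree] by (simp add: degree_mult_eq)
  then consider "degree U = 0" | "degree W = 0" by linarith
  then show "is_unit u \<or> is_unit v"
    by cases (use nz is_unit_bipoly_iff in \<open>auto simp: U W elim: degree_eq_zeroE\<close>)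
qed

text \<open>
  The translate of \<open>g\<close> lies in the kernel and vanishes at the origin, so it is \<open>g v\<close> for some \<open>v\<close>.
  Going once around the group, the translates of \<open>v\<close> multiply to \<open>1\<close>, so \<open>v\<close> is a constant.
\<close>

lemma generator_semi_invariant:
  assumes ker: "jac f g = 0" and ncg: "\<And>c. g \<noteq> const c"
    and dvd: "\<And>h. jac f h = 0 \<Longrightarrow> g dvd h - const (ev h 0 0)"
  shows "\<exists>\<chi>. \<chi> ^ d = 1 \<and> (\<forall>k. act k g = const (\<chi> ^ k) * g)"
proof -
  have g00: "ev g 0 0 = 0"
  proof (rule ccontr)
    assume "ev g 0 0 \<noteq> 0"
    have "g dvd g - (g - const (ev g 0 0))" by (rule dvd_diff[OF dvd_refl dvd[OF ker]])
    also have "g - (g - const (ev g 0 0)) = const (ev g 0 0)" by simp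
    finally have "g dvd const (ev g 0 0)" .
    moreover have "is_unit (const (ev g 0 0))"
      using \<open>ev g 0 0 \<noteq> 0\<close> unfolding is_unit_bipoly_iff by blast
    ultimately have "is_unit g" by (rule dvd_trans)
    then show False using ncg unfolding is_unit_bipoly_iff by blast
  qed
  have "g dvd act 1 g"
    using dvd[OF kernel_act[OF ker, of 1]] g00 by simp
  then obtain v where v: "act 1 g = g * v" by (elim dvdE)
  have act_prod: "act k g = g * (\<Prod>j<k. act j v)" for k
  proof (induction k)
    case (Suc k)
    have "act 1 (\<Prod>j<k. act j v) = (\<Prod>j<k. act (Suc j) v)"
      by (rule ev_eqI) (simp add: power_add mult.assoc mult.left_commute)
    then have "act (Suc k) g = g * (v * (\<Prod>j<k. act (Suc j) v))"
      by (simp only: act_Suc Suc.IH act_mult v mult.assoc)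
    also have "v * (\<Prod>j<k. act (Suc j) v) = (\<Prod>j<Suc k. act j v)"
      unfolding prod.lessThan_Suc_shift by simp
    finally show ?case .
  qed simp
  have "g * (\<Prod>j<d. act j v) = g * 1" using act_prod[of d] by simp
  then have "(\<Prod>j<d. act j v) = 1" using ncg[of 0] by simp
  moreover have "act 0 v dvd (\<Prod>j<d. act j v)" using d_pos by (intro dvd_prodI) auto
  ultimately have "is_unit v" by simp
  then obtain \<chi> where \<chi>: "\<chi> \<noteq> 0" "v = const \<chi>" unfolding is_unit_bipoly_iff by blast
  have act_g: "act k g = const (\<chi> ^ k) * g" for k
  proof -
    have "(\<Prod>j<k. act j v) = const (\<chi> ^ k)" unfolding \<chi> by (rule ev_eqI) simp
    then show ?thesis using act_prod[of k] by (simp add: mult.commute)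
  qed
  have "const (\<chi> ^ d) * g = const 1 * g" using act_g[of d] by simp
  then have "\<chi> ^ d = 1" using ncg[of 0] by (simp del: const_simps(2))
  with act_g show ?thesis by blast
qed

end

context cyclic_quotient
begin

text \<open>
  All translates of \<open>s\<^sub>0\<close> are slices up to constants: the Jacobian of the translates of \<open>g\<close> and \<open>s\<^sub>0\<close> is
  \<open>\<zeta>\<^sup>1\<^sup>+\<^sup>e\<close> to the appropriate power, which forces the weight \<open>\<mu> = \<zeta>\<^sup>1\<^sup>+\<^sup>e / \<chi>\<close>.  The average with
  respect to this weight is a semi-invariant slice.
\<close>

lemma semi_invariant_slice:
  assumes \<chi>d: "\<chi> ^ d = 1" and act_g: "\<And>k. act k g = const (\<chi> ^ k) * g" and s0: "jac g s0 = 1"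
  shows "\<exists>s \<mu>. jac g s = 1 \<and> act 1 s = const \<mu> * s"
proof -
  have \<chi>0: "\<chi> \<noteq> 0" using \<chi>d d_pos by (auto simp: power_0_left)
  define \<mu> where "\<mu> = \<zeta> ^ (1 + e) / \<chi>"
  have \<mu>0: "\<mu> \<noteq> 0" using \<chi>0 by (simp add: \<mu>_def)
  have \<mu>d: "\<mu> ^ d = 1"
    by (simp add: \<mu>_def power_divide \<chi>d power_mult_distrib root_power_eq_1_iff flip: power_mult)
  have jac_act_s: "jac g (act k s0) = const (\<mu> ^ k)" for k
  proof -
    have act1: "act k 1 = 1" by (rule ev_eqI) simp
    have "const (\<chi> ^ k) * jac g (act k s0) = jac (act k g) (act k s0)"
      by (simp only: act_g jac_const_mult_left)
    also have "\<dots> = const (\<zeta> ^ (k + e * k))" by (simp only: jac_act s0 act1 mult_1_right)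
    also have "\<dots> = const (\<chi> ^ k) * const (\<mu> ^ k)"
      using \<chi>0 by (intro ev_eqI) (simp add: \<mu>_def power_divide power_mult_distrib flip: power_add power_mult)
    finally have "const (\<chi> ^ k) * jac g (act k s0) = const (\<chi> ^ k) * const (\<mu> ^ k)" .
    then show ?thesis using \<chi>0 by simp
  qed
  define s where "s = (\<Sum>k<d. const (1 / (of_nat d * \<mu> ^ k)) * act k s0)"
  have "jac g s = (\<Sum>k<d. const (1 / (of_nat d * \<mu> ^ k)) * const (\<mu> ^ k))"
    by (simp add: s_def jac_sum jac_mult jac_act_s)
  also have "\<dots> = 1"
    using d_pos \<mu>0 by (intro ev_eqI) simp
  finally have "jac g s = 1" .
  moreover have "act 1 s = const \<mu> * s"
  proof (rule ev_eqI)
    fix x y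
    define F where "F k = 1 / (of_nat d * \<mu> ^ k) * ev s0 (\<zeta> ^ k * x) (\<zeta> ^ (e * k) * y)" for k
    have "ev (act 1 s) x y = (\<Sum>k<d. \<mu> * F (Suc k))"
      using \<mu>0 by (simp add: s_def F_def power_add mult.assoc mult.left_commute)
    also have "\<dots> = \<mu> * (\<Sum>k<d. F k)"
      unfolding sum_distrib_left[symmetric]
      by (subst sum_cyclic_shift[OF d_pos]) (simp_all add: F_def \<mu>d)
    also have "\<dots> = ev (const \<mu> * s) x y" by (simp add: s_def F_def)
    finally show "ev (act 1 s) x y = ev (const \<mu> * s) x y" .
  qed
  ultimately show ?thesis by blast
qed

text \<open>
  The Jacobian does not vanish at the origin, so one of the two products of first derivatives
  there is nonzero.  A semi-invariant with nonzero derivative in \<open>x\<close> at the origin has the weight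
  of \<open>x\<close>, and likewise for \<open>y\<close>.
\<close>

lemma coordinate_weights:
  assumes s: "jac g s = 1" and act_g: "act 1 g = const \<chi> * g" and act_s: "act 1 s = const \<mu> * s"
  shows "(\<chi> = \<zeta> \<and> \<mu> = \<zeta> ^ e) \<or> (\<chi> = \<zeta> ^ e \<and> \<mu> = \<zeta>)"
proof -
  have lin: "\<zeta> * ev (dx h) 0 0 = c * ev (dx h) 0 0" "\<zeta> ^ e * ev (dy h) 0 0 = c * ev (dy h) 0 0"
    if "act 1 h = const c * h" for h c
  proof -
    have "ev (dx (act 1 h)) 0 0 = ev (dx (const c * h)) 0 0" "ev (dy (act 1 h)) 0 0 = ev (dy (const c * h)) 0 0"
      by (simp_all only: that)
    then show "\<zeta> * ev (dx h) 0 0 = c * ev (dx h) 0 0" "\<zeta> ^ e * ev (dy h) 0 0 = c * ev (dy h) 0 0"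
      by (simp_all add: dx_act dy_act)
  qed
  have "ev (jac g s) 0 0 = 1" by (simp add: s)
  then have "ev (dx g) 0 0 * ev (dy s) 0 0 \<noteq> 0 \<or> ev (dy g) 0 0 * ev (dx s) 0 0 \<noteq> 0"
    by (auto simp: jac_def)
  then show ?thesis using lin[OF act_g] lin[OF act_s] by auto
qed

text \<open>
  Invariance of \<open>R(g)\<close> means that only exponents divisible by \<open>d\<close> occur in \<open>R\<close>, and the relation
  \<open>g\<^sup>d = W(R(g))\<close> bounds the degree of \<open>R\<close> by \<open>d\<close>.
\<close>

lemma invariant_polynomial_in_semi_invariant:
  assumes ncg: "\<And>c. g \<noteq> const c" and act_g: "act 1 g = const \<chi> * g"
    and \<chi>_order: "\<And>n. \<chi> ^ n = 1 \<longleftrightarrow> d dvd n"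
    and inv: "invariant (subst1 R g)" and R_nc: "degree R \<noteq> 0" and W: "g ^ d = subst1 W (subst1 R g)"
  shows "\<exists>\<alpha> \<beta>. \<alpha> \<noteq> 0 \<and> subst1 R g = const \<alpha> * g ^ d + const \<beta>"
proof -
  have "subst1 (pcompose R [:0, \<chi>:]) g = act 1 (subst1 R g)"
  proof (rule ev_eqI)
    fix x y
    have "ev (act 1 g) x y = \<chi> * ev g x y" by (simp only: act_g ev_simps)
    then show "ev (subst1 (pcompose R [:0, \<chi>:]) g) x y = ev (act 1 (subst1 R g)) x y"
      by (simp add: poly_pcompose mult.commute)
  qed
  then have "subst1 (pcompose R [:0, \<chi>:]) g = subst1 R g" by (simp only: act_invariant[OF inv])
  then have "pcompose R [:0, \<chi>:] = R" by (rule subst1_inject[OF ncg])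
  then have coeff_R: "\<chi> ^ n * coeff R n = coeff R n" for n
    by (metis coeff_pcompose_linear)
  have "subst1 ([:0, 1:] ^ d) g = subst1 W (subst1 R g)" by (simp only: subst1_simps W)
  also have "\<dots> = subst1 (pcompose W R) g" by (rule ev_eqI) (simp add: poly_pcompose)
  finally have "[:0, 1:] ^ d = pcompose W R" by (rule subst1_inject[OF ncg])
  from arg_cong[OF this, of degree] have deg: "degree W * degree R = d"
    by (simp add: degree_pcompose degree_power_eq)
  have "\<chi> ^ degree R = 1" using coeff_R[of "degree R"] R_nc by auto
  then have "d dvd degree R" by (simp add: \<chi>_order)
  moreover have "degree R dvd d" using deg by (metis dvd_triv_right)
  ultimately have deg_R: "degree R = d" by (rule dvd_antisym[symmetric])
  have "coeff R n = coeff (monom (lead_coeff R) d + [:coeff R 0:]) n" for n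
  proof -
    consider "n = 0" | "0 < n" "n < d" | "n = d" "n > 0" | "n > d" by linarith
    then show ?thesis
    proof cases
      case 2
      then have "\<chi> ^ n \<noteq> 1" by (auto simp: \<chi>_order dest: dvd_imp_le)
      then have "coeff R n = 0" using coeff_R[of n] by simp
      with 2 show ?thesis by (simp add: coeff_pCons split: nat.splits)
    qed (use d_pos deg_R in \<open>auto simp: coeff_pCons coeff_eq_0 split: nat.splits\<close>)
  qed
  then have R_eq: "R = monom (lead_coeff R) d + [:coeff R 0:]" by (rule poly_eqI)
  have "poly R z = lead_coeff R * z ^ d + coeff R 0" for z
    using arg_cong[OF R_eq, of "\<lambda>p. poly p z"] unfolding poly_add poly_monom by simp
  then have "subst1 R g = const (lead_coeff R) * g ^ d + const (coeff R 0)"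
    by (intro ev_eqI) simp
  moreover have "lead_coeff R \<noteq> 0" using R_nc by auto
  ultimately show ?thesis by blast
qed

end

context line_fibration
begin

theorem normal_form:
  obtains g s \<chi> \<mu> \<alpha> \<beta> where
    "\<forall>h. \<exists>E. h = subst E g s" "\<forall>E. subst E g s = 0 \<longrightarrow> E = 0"
    "act 1 g = const \<chi> * g" "act 1 s = const \<mu> * s"
    "(\<chi> = \<zeta> \<and> \<mu> = \<zeta> ^ e) \<or> (\<chi> = \<zeta> ^ e \<and> \<mu> = \<zeta>)"
    "\<alpha> \<noteq> 0" "f = const \<alpha> * g ^ d + const \<beta>"
proof -
  obtain g where kernel_f: "\<And>h. jac f h = 0 \<longleftrightarrow> (\<exists>U. h = subst1 U g)" and ncg: "\<And>c. g \<noteq> const c"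
    and dvd: "\<And>h. jac f h = 0 \<Longrightarrow> g dvd h - const (ev h 0 0)"
    using kernel_generator by metis
  have kg: "jac f g = 0" unfolding kernel_f by (rule exI[of _ "[:0, 1:]"]) simp
  obtain R where R: "f = subst1 R g" using kernel_f[of f] by auto
  have R_nc: "degree R \<noteq> 0"
  proof
    assume "degree R = 0"
    then obtain c where "R = [:c:]" by (rule degree_eq_zeroE)
    then show False using R nonconst by simp
  qed
  have dR: "subst1 (pderiv R) g \<noteq> 0"
  proof
    assume "subst1 (pderiv R) g = 0"
    then have "pderiv R = 0" by (rule subst1_eq_0[OF ncg])
    then show False using R_nc unfolding pderiv_eq_0_iff by (rule notE[rotated])
  qed
  have jac_f: "jac f h = subst1 (pderiv R) g * jac g h" for h by (simp only: R jac_subst1_left)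
  have kernel_g: "\<exists>U. h = subst1 U g" if "jac g h = 0" for h
    using kernel_f[of h] that by (simp add: jac_f)
  have nil_g: "\<exists>n. (jac g ^^ n) h = 0" for h
  proof -
    have "jac g (subst1 (pderiv R) g ^ n) = 0" for n by (simp add: jac_power)
    then have "(jac f ^^ n) h = subst1 (pderiv R) g ^ n * (jac g ^^ n) h" for n
      by (induction n) (simp_all add: jac_f jac_mult mult.assoc)
    then show ?thesis using jac_locally_nilpotent[of h] dR by auto
  qed
  obtain s0 where s0: "jac g s0 = 1"
    using slice_exists[OF ncg generator_fibres_prime[OF kernel_f ncg] kernel_g nil_g] by blast
  obtain \<chi> where \<chi>d: "\<chi> ^ d = 1" and act_g: "\<And>k. act k g = const (\<chi> ^ k) * g"
    using generator_semi_invariant[OF kg ncg dvd] by blast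
  obtain s \<mu> where s: "jac g s = 1" and act_s: "act 1 s = const \<mu> * s"
    using semi_invariant_slice[OF \<chi>d act_g s0] by blast
  have act_g1: "act 1 g = const \<chi> * g" using act_g[of 1] by simp
  have gen: "\<forall>h. \<exists>E. h = subst E g s" using slice_generates[OF kernel_g nil_g s] by (rule allI)
  have indep: "\<forall>E. subst E g s = 0 \<longrightarrow> E = 0"
    using slice_algebraically_independent[OF ncg s] by (intro allI impI)
  note weights = coordinate_weights[OF s act_g1 act_s]
  have \<chi>_order: "\<chi> ^ n = 1 \<longleftrightarrow> d dvd n" for n
    using weights root_power_eq_1_iff[of n] root_power_eq_1_iff[of "e * n"] coprime_e
    by (auto simp: coprime_commute coprime_dvd_mult_right_iff simp flip: power_mult)
  have "act 1 (g ^ d) = act 1 g ^ d" by (rule ev_eqI) simp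
  also have "\<dots> = g ^ d" unfolding act_g1 by (rule ev_eqI) (simp add: power_mult_distrib \<chi>d)
  finally have "invariant (g ^ d)" by (simp only: invariant_iff_act)
  then obtain W where "g ^ d = subst1 W f" using invariant_kernel[of "g ^ d"] kg by (auto simp: jac_power)
  then obtain \<alpha> \<beta> where "\<alpha> \<noteq> 0" "f = const \<alpha> * g ^ d + const \<beta>"
    using invariant_polynomial_in_semi_invariant[OF ncg act_g1 \<chi>_order _ R_nc] f_inv unfolding R by blast
  then show thesis using that[OF gen indep act_g1 act_s weights] by blast
qed

end

section \<open>Every fibration is conjugate to a coordinate fibration\<close>

context cyclic_quotient
begin

lemma Aut_of_plane_automorphism:
  assumes inv: "\<And>x y. ev k1 (ev h1 x y) (ev h2 x y) = x" "\<And>x y. ev k2 (ev h1 x y) (ev h2 x y) = y"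
    "\<And>x y. ev h1 (ev k1 x y) (ev k2 x y) = x" "\<And>x y. ev h2 (ev k1 x y) (ev k2 x y) = y"
    and h: "\<And>x y x' y'. orb x y = orb x' y' \<Longrightarrow> orb (ev h1 x y) (ev h2 x y) = orb (ev h1 x' y') (ev h2 x' y')"
    and k: "\<And>x y x' y'. orb x y = orb x' y' \<Longrightarrow> orb (ev k1 x y) (ev k2 x y) = orb (ev k1 x' y') (ev k2 x' y')"
  shows "\<exists>\<alpha>\<in>Aut V. \<forall>x y. \<alpha> (orb x y) = orb (ev h1 x y) (ev h2 x y)"
proof -
  define lift where "lift u1 u2 = (\<lambda>P\<in>points V. case (SOME p. p \<in> P) of (x, y) \<Rightarrow> orb (ev u1 x y) (ev u2 x y))"
    for u1 u2
  have lift: "lift u1 u2 (orb x y) = orb (ev u1 x y) (ev u2 x y)"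
    if u: "\<And>x y x' y'. orb x y = orb x' y' \<Longrightarrow> orb (ev u1 x y) (ev u2 x y) = orb (ev u1 x' y') (ev u2 x' y')"
    for u1 u2 x y
  proof -
    obtain x' y' where xy: "(SOME p. p \<in> orb x y) = (x', y')" by (cases "SOME p. p \<in> orb x y") auto
    have "(x', y') \<in> orb x y" unfolding xy[symmetric] using orb_self by (rule someI)
    then have "orb x y = orb x' y'" unfolding orb_eq_iff by (auto simp: orb_eq)
    from u[OF this] show ?thesis by (simp add: lift_def xy)
  qed
  have morph: "morphism V V (lift u1 u2)"
    if u: "\<And>x y x' y'. orb x y = orb x' y' \<Longrightarrow> orb (ev u1 x y) (ev u2 x y) = orb (ev u1 x' y') (ev u2 x' y')"
    for u1 u2
    unfolding morphism_def
  proof (intro conjI ballI)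
    have "lift u1 u2 P \<in> points V" if "P \<in> points V" for P
      using that lift[OF u] by (auto elim!: points_V_E)
    then show "lift u1 u2 \<in> points V \<rightarrow>\<^sub>E points V" by (auto simp: lift_def)
    fix \<rho> assume "\<rho> \<in> regular V"
    then obtain w where w: "invariant w" "\<rho> = descend w" by (auto simp: regular_V)
    have "invariant (subst w u1 u2)"
      unfolding invariant_def ev_subst
    proof (intro allI)
      fix x y
      have "orb (\<zeta> * x) (\<zeta> ^ e * y) = orb x y" using orb_shift[of 1 x y] by simp
      from invariant_orb[OF w(1) u[OF this]]
      show "ev w (ev u1 (\<zeta> * x) (\<zeta> ^ e * y)) (ev u2 (\<zeta> * x) (\<zeta> ^ e * y)) = ev w (ev u1 x y) (ev u2 x y)" .
    qed
    moreover have "compose (points V) \<rho> (lift u1 u2) = descend (subst w u1 u2)"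
    proof
      fix P show "compose (points V) \<rho> (lift u1 u2) P = descend (subst w u1 u2) P"
      proof (cases "P \<in> points V")
        case True
        then obtain x y where "P = orb x y" by (rule points_V_E)
        then show ?thesis
          using lift[OF u] w \<open>invariant (subst w u1 u2)\<close> by (simp add: compose_def)
      qed (simp add: compose_def descend_def)
    qed
    ultimately show "compose (points V) \<rho> (lift u1 u2) \<in> regular V" by (auto simp: regular_V)
  qed
  have "\<forall>P\<in>points V. lift k1 k2 (lift h1 h2 P) = P" "\<forall>P\<in>points V. lift h1 h2 (lift k1 k2 P) = P"
    using lift[OF h] lift[OF k] inv by (auto elim!: points_V_E)
  then have "lift h1 h2 \<in> Aut V"
    unfolding Aut_def isomorphism_def using morph[OF h] morph[OF k] by blast
  then show ?thesis using lift[OF h] by blast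
qed

lemma affine_Aut:
  assumes "\<alpha> \<noteq> 0"
  shows "(\<lambda>z. \<alpha> * z + \<beta>) \<in> Aut affine_line"
proof -
  have morph: "morphism affine_line affine_line (\<lambda>z. u * z + v)" for u v
  proof -
    have "g \<circ> (\<lambda>z. u * z + v) \<in> range poly" if "g \<in> range poly" for g
    proof -
      from that obtain G where "g = poly G" by blast
      then have "g \<circ> (\<lambda>z. u * z + v) = poly (pcompose G [:v, u:])"
        by (simp add: fun_eq_iff poly_pcompose algebra_simps)
      then show ?thesis by simp
    qed
    then show ?thesis by (auto simp: morphism_def compose_def o_def restrict_UNIV)
  qed
  show ?thesis
    unfolding Aut_def isomorphism_def mem_Collect_eq
  proof (intro conjI exI[of _ "\<lambda>z. (1 / \<alpha>) * z + (- \<beta> / \<alpha>)"] ballI)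
    show "(1 / \<alpha>) * (\<alpha> * z + \<beta>) + (- \<beta> / \<alpha>) = z" for z
      using assms by (simp add: add_divide_distrib)
    show "\<alpha> * ((1 / \<alpha>) * z + (- \<beta> / \<alpha>)) + \<beta> = z" for z
      using assms by (simp add: right_diff_distrib)
  qed (rule morph)+
qed

abbreviation x_fibration :: "(complex \<times> complex) set \<Rightarrow> complex" where
  "x_fibration \<equiv> descend (X_var ^ d)"

abbreviation y_fibration :: "(complex \<times> complex) set \<Rightarrow> complex" where
  "y_fibration \<equiv> descend (Y_var ^ d)"

lemma invariant_powers [simp]: "invariant (X_var ^ d)" "invariant (Y_var ^ d)"
  using invariant_generators(1,2) by simp_all

text \<open>
  The fibre over \<open>0\<close> is allowed to be exceptional; for the coordinate fibrations it contains the
  image of the origin.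
\<close>

lemma A1_fibration_of_parametrized:
  assumes h: "invariant h" and surj: "\<And>t. \<exists>x y. ev h x y = t"
    and par: "\<And>t. t \<noteq> 0 \<Longrightarrow> \<exists>p q S. param_fibre h t p q S"
  shows "A1_fibration V (descend h)"
  unfolding A1_fibration_def
proof (intro conjI)
  have "compose (points V) (poly G) (descend h) = descend (subst1 G h)" for G
  proof
    have inv: "invariant (subst1 G h)" using h by (simp add: invariant_def)
    fix P show "compose (points V) (poly G) (descend h) P = descend (subst1 G h) P"
    proof (cases "P \<in> points V")
      case True
      then obtain x y where "P = orb x y" by (rule points_V_E)
      then show ?thesis using h inv by (simp add: compose_def)
    qed (simp add: compose_def descend_def)
  qed
  moreover have "invariant (subst1 G h)" for G using h by (simp add: invariant_def)
  ultimately have "compose (points V) (poly G) (descend h) \<in> regular V" for G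
    using descend_in_regular by simp
  moreover have "descend h \<in> points V \<rightarrow>\<^sub>E UNIV" by (simp add: descend_def PiE_def)
  ultimately show "morphism V affine_line (descend h)" by (auto simp: morphism_def)
  have "t \<in> descend h ` points V" for t
  proof -
    obtain x y where "ev h x y = t" using surj by blast
    then have "t = descend h (orb x y)" using h by simp
    then show ?thesis using orb_in_V by blast
  qed
  then show "descend h ` points V = points affine_line" by auto
  have "{t \<in> points affine_line. \<not> isomorphic (fibre V (descend h) t) affine_line} \<subseteq> {0}"
    using par parametrized_fibre_is_line[OF h] by blast
  then show "finite {t \<in> points affine_line. \<not> isomorphic (fibre V (descend h) t) affine_line}"
    by (rule finite_subset) simp
qed

lemma A1_fibration_x: "A1_fibration V x_fibration"
proof (rule A1_fibration_of_parametrized)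
  show "\<exists>x y. ev (X_var ^ d) x y = t" for t
    using nth_root_exists[OF d_pos, of t] by auto
next
  fix t :: complex assume "t \<noteq> 0"
  obtain r where r: "r ^ d = t" using nth_root_exists[OF d_pos] by blast
  with \<open>t \<noteq> 0\<close> d_pos have "r \<noteq> 0" by auto
  note inv = invariant_generators(4)
  define S where "S = const (1 / r ^ ((d - 1) * e)) * (X_var ^ ((d - 1) * e) * Y_var ^ 1)"
  have "param_fibre (X_var ^ d) t [:r:] [:0, 1:] S"
    unfolding param_fibre_def
  proof (intro conjI allI)
    show "invariant S" using inv by (simp add: S_def invariant_def)
    show "ev S (poly [:r:] s) (poly [:0, 1:] s) = s" for s using \<open>r \<noteq> 0\<close> by (simp add: S_def)
    fix x y
    show "ev (X_var ^ d) x y = t \<longleftrightarrow> (\<exists>s. orb x y = orb (poly [:r:] s) (poly [:0, 1:] s))"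
    proof
      assume "ev (X_var ^ d) x y = t"
      then have "r ^ d = x ^ d" using r by simp
      then obtain k where "r = \<zeta> ^ k * x" using equal_powers by blast
      then have "orb x y = orb r (\<zeta> ^ (e * k) * y)" by simp
      then show "\<exists>s. orb x y = orb (poly [:r:] s) (poly [:0, 1:] s)" by auto
    next
      assume "\<exists>s. orb x y = orb (poly [:r:] s) (poly [:0, 1:] s)"
      then obtain s where "orb x y = orb r s" by auto
      from invariant_orb[OF invariant_powers(1) this] show "ev (X_var ^ d) x y = t"
        by (simp add: r)
    qed
  qed
  then show "\<exists>p q S. param_fibre (X_var ^ d) t p q S" by blast
qed (rule invariant_powers)

lemma A1_fibration_y: "A1_fibration V y_fibration"
proof (rule A1_fibration_of_parametrized)
  show "\<exists>x y. ev (Y_var ^ d) x y = t" for t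
    using nth_root_exists[OF d_pos, of t] by auto
next
  fix t :: complex assume "t \<noteq> 0"
  obtain r where r: "r ^ d = t" using nth_root_exists[OF d_pos] by blast
  with \<open>t \<noteq> 0\<close> d_pos have "r \<noteq> 0" by auto
  note inv = invariant_generators(3)
  define S where "S = const (1 / r ^ b) * (X_var ^ 1 * Y_var ^ b)"
  have "param_fibre (Y_var ^ d) t [:0, 1:] [:r:] S"
    unfolding param_fibre_def
  proof (intro conjI allI)
    show "invariant S" using inv by (simp add: S_def invariant_def)
    show "ev S (poly [:0, 1:] s) (poly [:r:] s) = s" for s using \<open>r \<noteq> 0\<close> by (simp add: S_def)
    fix x y
    show "ev (Y_var ^ d) x y = t \<longleftrightarrow> (\<exists>s. orb x y = orb (poly [:0, 1:] s) (poly [:r:] s))"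
    proof
      assume "ev (Y_var ^ d) x y = t"
      then have "r ^ d = y ^ d" using r by simp
      then obtain j where "r = \<zeta> ^ j * y" using equal_powers by blast
      moreover obtain k where "\<zeta> ^ (e * k) = \<zeta> ^ j" using root_e_surjective by blast
      ultimately have "orb x y = orb (\<zeta> ^ k * x) r" using orb_shift[of k x y] by simp
      then show "\<exists>s. orb x y = orb (poly [:0, 1:] s) (poly [:r:] s)" by auto
    next
      assume "\<exists>s. orb x y = orb (poly [:0, 1:] s) (poly [:r:] s)"
      then obtain s where "orb x y = orb s r" by auto
      from invariant_orb[OF invariant_powers(2) this] show "ev (Y_var ^ d) x y = t"
        by (simp add: r)
    qed
  qed
  then show "\<exists>p q S. param_fibre (Y_var ^ d) t p q S" by blast
qed (rule invariant_powers)

lemma conjugateI: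
  assumes "A1_fibration V \<phi>" "A1_fibration V \<phi>'" "\<alpha> \<in> Aut V" "\<beta> \<in> Aut affine_line"
    and "\<And>x y. \<phi>' (orb x y) = \<beta> (\<phi> (\<alpha> (orb x y)))"
  shows "(\<phi>, \<phi>') \<in> conjugate_fibrations V"
proof -
  have "\<phi>' \<in> extensional (points V)" using assms(2) by (auto simp: A1_fibration_def morphism_def PiE_def)
  then have "\<phi>' = compose (points V) \<beta> (compose (points V) \<phi> \<alpha>)"
    using assms(5) by (auto simp: fun_eq_iff compose_def extensional_def points_V)
  then show ?thesis using assms(1-4) unfolding conjugate_fibrations_def by blast
qed

lemma fibration_gives_lines:
  assumes \<phi>: "A1_fibration V \<phi>"
  obtains f T p q S where "\<phi> = descend f" "line_fibration d e \<zeta> f T p q S"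
proof -
  have "morphism V affine_line \<phi>" and surj: "\<phi> ` points V = UNIV"
    and fin: "finite {t. \<not> isomorphic (fibre V \<phi> t) affine_line}"
    using \<phi> by (simp_all add: A1_fibration_def)
  then have "compose (points V) (poly [:0, 1:]) \<phi> \<in> regular V" and ext: "\<phi> \<in> extensional (points V)"
    by (auto simp: morphism_def PiE_def)
  moreover have "compose (points V) (poly [:0, 1:]) \<phi> = \<phi>"
    using ext by (auto simp: compose_def fun_eq_iff extensional_def)
  ultimately obtain f where f: "invariant f" "\<phi> = descend f" by (auto simp: regular_V)
  have nonconst: "f \<noteq> const c" for c
  proof
    assume "f = const c"
    then have "\<phi> P = c" if "P \<in> points V" for P using that f by (auto elim!: points_V_E)
    moreover obtain P where "P \<in> points V" "\<phi> P = c + 1" using surj by (metis UNIV_I imageE)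
    ultimately show False by fastforce
  qed
  define T where "T = {t. isomorphic (fibre V \<phi> t) affine_line} \<inter> {t. squarefree (f - const t)} - {ev f 0 0}"
  have "- T = {t. \<not> isomorphic (fibre V \<phi> t) affine_line} \<union> {t. \<not> squarefree (f - const t)} \<union> {ev f 0 0}"
    by (auto simp: T_def)
  then have "finite (- T)" using fin generic_fibre_squarefree[OF nonconst] by simp
  moreover have "\<forall>t\<in>T. \<exists>p q S. param_fibre f t p q S"
    using line_fibre_parametrized[OF f(1)] by (auto simp: T_def f(2))
  then obtain p q S where "\<And>t. t \<in> T \<Longrightarrow> param_fibre f t (p t) (q t) (S t)" by metis
  ultimately have "line_fibration d e \<zeta> f T p q S"
    using f(1) nonconst by unfold_locales (auto simp: T_def)
  with f(2) show thesis by (rule that)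
qed

text \<open>
  The polynomials \<open>k\<^sub>1\<close> and \<open>k\<^sub>2\<close> expressing \<open>x\<close> and \<open>y\<close> through \<open>g\<close> and \<open>s\<close> invert the map \<open>(g, s)\<close>: on one
  side by definition, on the other side because \<open>g\<close> and \<open>s\<close> are algebraically independent.
\<close>

theorem fibration_conjugate_to_coordinate:
  assumes \<phi>: "A1_fibration V \<phi>"
  shows "(x_fibration, \<phi>) \<in> conjugate_fibrations V \<or> (y_fibration, \<phi>) \<in> conjugate_fibrations V"
proof -
  obtain f T p q S where f: "\<phi> = descend f" "line_fibration d e \<zeta> f T p q S"
    using fibration_gives_lines[OF \<phi>] .
  interpret line_fibration d e \<zeta> f T p q S by (rule f(2))
  obtain g s \<chi> \<mu> \<alpha> \<beta> where gen: "\<forall>h. \<exists>E. h = subst E g s"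
    and indep: "\<forall>E. subst E g s = 0 \<longrightarrow> E = 0"
    and act: "act 1 g = const \<chi> * g" "act 1 s = const \<mu> * s"
    and weights: "(\<chi> = \<zeta> \<and> \<mu> = \<zeta> ^ e) \<or> (\<chi> = \<zeta> ^ e \<and> \<mu> = \<zeta>)"
    and \<alpha>: "\<alpha> \<noteq> 0" "f = const \<alpha> * g ^ d + const \<beta>"
    by (rule normal_form)
  obtain k1 where k1: "X_var = subst k1 g s" using gen by blast
  obtain k2 where k2: "Y_var = subst k2 g s" using gen by blast
  have inv1: "ev k1 (ev g x y) (ev s x y) = x" "ev k2 (ev g x y) (ev s x y) = y" for x y
    using arg_cong[OF k1, of "\<lambda>h. ev h x y"] arg_cong[OF k2, of "\<lambda>h. ev h x y"] by simp_all
  have "subst g k1 k2 - X_var = 0" "subst s k1 k2 - Y_var = 0"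
    by (rule indep[rule_format], rule ev_eqI, simp add: inv1)+
  then have inv2: "ev g (ev k1 x y) (ev k2 x y) = x" "ev s (ev k1 x y) (ev k2 x y) = y" for x y
    by (metis ev_simps(9,10) ev_subst right_minus_eq)+
  have act1: "ev g (\<zeta> * x) (\<zeta> ^ e * y) = \<chi> * ev g x y" "ev s (\<zeta> * x) (\<zeta> ^ e * y) = \<mu> * ev s x y" for x y
    using arg_cong[OF act(1), of "\<lambda>h. ev h x y"] arg_cong[OF act(2), of "\<lambda>h. ev h x y"] by simp_all
  have actk: "ev g (\<zeta> ^ k * x) (\<zeta> ^ (e * k) * y) = \<chi> ^ k * ev g x y"
    "ev s (\<zeta> ^ k * x) (\<zeta> ^ (e * k) * y) = \<mu> ^ k * ev s x y" for k x y
  proof (induction k)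
    case (Suc k)
    {
      case 1
      show ?case using act1(1)[of "\<zeta> ^ k * x" "\<zeta> ^ (e * k) * y"] Suc(1) by (simp add: power_add mult.assoc)
    next
      case 2
      show ?case using act1(2)[of "\<zeta> ^ k * x" "\<zeta> ^ (e * k) * y"] Suc(2) by (simp add: power_add mult.assoc)
    }
  qed simp_all
  have actk': "ev k1 (\<chi> ^ k * x) (\<mu> ^ k * y) = \<zeta> ^ k * ev k1 x y"
    "ev k2 (\<chi> ^ k * x) (\<mu> ^ k * y) = \<zeta> ^ (e * k) * ev k2 x y" for k x y
    using actk[of k "ev k1 x y" "ev k2 x y"] inv1[of "\<zeta> ^ k * ev k1 x y" "\<zeta> ^ (e * k) * ev k2 x y"]
    by (simp_all add: inv2)
  have \<phi>_eq: "\<phi> (orb x y) = \<alpha> * ev g x y ^ d + \<beta>" for x y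
    using f_inv by (simp add: f(1)) (simp add: \<alpha>(2))
  note aff = affine_Aut[OF \<alpha>(1), of \<beta>]
  from weights show ?thesis
  proof
    assume w: "\<chi> = \<zeta> \<and> \<mu> = \<zeta> ^ e"
    have "\<exists>\<alpha>\<in>Aut V. \<forall>x y. \<alpha> (orb x y) = orb (ev g x y) (ev s x y)"
    proof (rule Aut_of_plane_automorphism[OF inv1 inv2])
      fix x y x' y' assume "orb x y = orb x' y'"
      then obtain k where "x' = \<zeta> ^ k * x" "y' = \<zeta> ^ (e * k) * y" using orb_eq_iff by metis
      then show "orb (ev g x y) (ev s x y) = orb (ev g x' y') (ev s x' y')"
        "orb (ev k1 x y) (ev k2 x y) = orb (ev k1 x' y') (ev k2 x' y')"
        using actk actk' w by (simp_all flip: power_mult)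
    qed
    then obtain A where "A \<in> Aut V" "\<And>x y. A (orb x y) = orb (ev g x y) (ev s x y)" by blast
    then have "(x_fibration, \<phi>) \<in> conjugate_fibrations V"
      using \<phi>_eq by (intro conjugateI[OF A1_fibration_x \<phi> _ aff]) auto
    then show ?thesis ..
  next
    assume w: "\<chi> = \<zeta> ^ e \<and> \<mu> = \<zeta>"
    have "\<exists>\<alpha>\<in>Aut V. \<forall>x y. \<alpha> (orb x y) = orb (ev s x y) (ev g x y)"
    proof (rule Aut_of_plane_automorphism[of "subst k1 Y_var X_var" s g "subst k2 Y_var X_var"])
      fix x y x' y' assume "orb x y = orb x' y'"
      then obtain k where "x' = \<zeta> ^ k * x" "y' = \<zeta> ^ (e * k) * y" using orb_eq_iff by metis
      then show "orb (ev s x y) (ev g x y) = orb (ev s x' y') (ev g x' y')"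
        "orb (ev (subst k1 Y_var X_var) x y) (ev (subst k2 Y_var X_var) x y)
          = orb (ev (subst k1 Y_var X_var) x' y') (ev (subst k2 Y_var X_var) x' y')"
        using actk actk' w by (simp_all flip: power_mult)
    qed (simp_all add: inv1 inv2)
    then obtain A where "A \<in> Aut V" "\<And>x y. A (orb x y) = orb (ev s x y) (ev g x y)" by blast
    then have "(y_fibration, \<phi>) \<in> conjugate_fibrations V"
      using \<phi>_eq by (intro conjugateI[OF A1_fibration_y \<phi> _ aff]) auto
    then show ?thesis ..
  qed
qed

end

section \<open>The two coordinate fibrations\<close>

lemma only_root_zero_imp_monom:
  fixes p :: "complex poly"
  assumes "p \<noteq> 0" and "\<And>x. poly p x = 0 \<Longrightarrow> x = 0"
  shows "p = monom (lead_coeff p) (degree p)"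
proof -
  obtain q where q: "p = [:- 0, 1:] ^ order 0 p * q" "\<not> [:- 0, 1:] dvd q"
    using order_decomp[OF assms(1)] by blast
  have "degree q = 0"
  proof (rule ccontr)
    assume "degree q \<noteq> 0"
    then obtain x where x: "poly q x = 0" using complex_root_exists by blast
    then have "poly p x = 0" by (subst q(1)) simp
    then have "x = 0" by (rule assms(2))
    then show False using x q(2) by (simp add: poly_eq_0_iff_dvd)
  qed
  then obtain c where "q = [:c:]" by (rule degree_eq_zeroE)
  then have p: "p = monom c (order 0 p)" using q(1) by (simp add: monom_altdef mult.commute)
  have "c \<noteq> 0" using p assms(1) by auto
  then have "degree p = order 0 p" by (subst p) (simp add: degree_monom_eq)
  moreover from this have "lead_coeff p = c" by (subst (1) p) simp
  ultimately show ?thesis using p by (simp only:)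
qed

lemma value_injective_imp_monom:
  fixes p :: "complex poly"
  assumes "\<And>x. poly p x = poly p 0 \<Longrightarrow> x = 0"
  shows "degree p > 0 \<and> p = monom (lead_coeff p) (degree p) + [:poly p 0:]"
proof -
  define q where "q = p - [:poly p 0:]"
  have "q \<noteq> 0"
  proof
    assume "q = 0"
    then have "poly q 1 = 0" by simp
    then show False using assms[of 1] by (simp add: q_def)
  qed
  moreover have "x = 0" if "poly q x = 0" for x using that assms by (simp add: q_def)
  ultimately have q: "q = monom (lead_coeff q) (degree q)" by (rule only_root_zero_imp_monom)
  have pq: "p = q + [:poly p 0:]" by (simp add: q_def)
  have deg: "degree q > 0"
  proof (rule ccontr)
    assume "\<not> degree q > 0"
    then obtain c where "q = [:c:]" by (auto elim: degree_eq_zeroE)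
    moreover have "poly q 0 = 0" by (simp add: q_def)
    ultimately show False using \<open>q \<noteq> 0\<close> by simp
  qed
  have "degree p = degree q" by (subst pq, rule degree_add_eq_left) (use deg in simp)
  moreover have "lead_coeff p = lead_coeff q"
    unfolding \<open>degree p = degree q\<close> using deg by (subst pq) (simp add: coeff_pCons split: nat.splits)
  ultimately show ?thesis using q pq deg by metis
qed

text \<open>
  All roots of unity whose order divides the degree are mapped to the same value.
\<close>

lemma injective_poly_degree:
  fixes p :: "complex poly"
  assumes "inj (poly p)"
  shows "degree p = 1"
proof -
  have *: "degree p > 0" "p = monom (lead_coeff p) (degree p) + [:poly p 0:]"
    using value_injective_imp_monom[of p] assms by (auto simp: inj_def)
  have p: "poly p z = lead_coeff p * z ^ degree p + poly p 0" for z
    using arg_cong[OF *(2), of "\<lambda>p. poly p z"] unfolding poly_add poly_monom by simp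
  have "z = 1" if "z ^ degree p = 1" for z :: complex
    by (rule injD[OF assms]) (simp only: p[of z] p[of 1] that power_one)
  then have "{z :: complex. z ^ degree p = 1} \<subseteq> {1}" by auto
  then have "card {z :: complex. z ^ degree p = 1} \<le> card {1 :: complex}" by (intro card_mono) auto
  then show ?thesis using *(1) by (simp add: card_roots_unity_eq)
qed

lemma Aut_affine_line:
  assumes "\<beta> \<in> Aut affine_line"
  shows "\<exists>c c0. c \<noteq> 0 \<and> (\<forall>z. \<beta> z = c * z + c0)"
proof -
  have "morphism affine_line affine_line \<beta>" using assms by (simp add: Aut_def isomorphism_def)
  then have "\<forall>g\<in>range poly. compose UNIV g \<beta> \<in> range poly" by (simp add: morphism_def affine_line_def)
  then have "compose UNIV (poly [:0, 1:]) \<beta> \<in> range poly" by blast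
  then obtain B where "compose UNIV (poly [:0, 1:]) \<beta> = poly B" by blast
  then have B: "\<beta> z = poly B z" for z by (auto simp: compose_def fun_eq_iff)
  obtain \<beta>' where "\<forall>z. \<beta>' (\<beta> z) = z" using assms by (rule Aut_inverse) (simp add: affine_line_def)
  then have "inj (poly B)" by (metis B injI)
  then have deg: "degree B = 1" by (rule injective_poly_degree)
  then obtain c0 c where "B = [:c0, c:]"
    by (metis One_nat_def degree_eq_zeroE degree_pCons_eq_if nat.inject old.nat.distinct(1) pCons_cases)
  moreover have "c \<noteq> 0" using deg calculation by auto
  ultimately show ?thesis using B by (intro exI[of _ c] exI[of _ c0]) (simp add: algebra_simps)
qed

lemma poly_at_constant_dvd:
  fixes U :: bipoly
  assumes "\<And>x. ev U x r = 0"
  shows "Y_var - const r dvd U"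
proof -
  have "poly (poly U [:r:]) x = 0" for x using assms[of x] by (simp add: ev_def)
  then have "poly U [:r:] = 0" using poly_all_0_iff_0 by blast
  then have "[:- [:r:], 1:] dvd U" by (simp only: poly_eq_0_iff_dvd)
  moreover have "Y_var - const r = [:- [:r:], 1:]" by (simp add: Y_var_def const_def)
  ultimately show ?thesis by (simp only:)
qed

context cyclic_quotient
begin

text \<open>
  Swapping the coordinates turns the action of \<open>\<zeta>\<close> into that of \<open>\<zeta>\<^sup>e\<close>, because \<open>(\<zeta>\<^sup>e)\<^sup>e = \<zeta>\<close>.
\<close>

lemma coordinate_fibrations_conjugate:
  assumes "[e\<^sup>2 = 1] (mod d)"
  shows "(x_fibration, y_fibration) \<in> conjugate_fibrations V"
proof -
  have swap: "orb y x = orb y' x'" if orb: "orb x y = orb x' y'" for x y x' y'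
  proof -
    obtain k where k: "x' = \<zeta> ^ k * x" "y' = \<zeta> ^ (e * k) * y" using orb unfolding orb_eq_iff by blast
    have "[e\<^sup>2 * k = 1 * k] (mod d)" using assms by (rule cong_scalar_right)
    then have "\<zeta> ^ (e * (e * k)) = \<zeta> ^ k" by (simp add: root_power_eq_iff power2_eq_square mult.assoc)
    then have "y' = \<zeta> ^ (e * k) * y \<and> x' = \<zeta> ^ (e * (e * k)) * x" by (simp add: k)
    then show ?thesis unfolding orb_eq_iff by blast
  qed
  have "\<exists>\<alpha>\<in>Aut V. \<forall>x y. \<alpha> (orb x y) = orb (ev Y_var x y) (ev X_var x y)"
  proof (rule Aut_of_plane_automorphism[of Y_var Y_var X_var X_var])
    fix x y x' y' assume "orb x y = orb x' y'"
    from swap[OF this]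
    show "orb (ev Y_var x y) (ev X_var x y) = orb (ev Y_var x' y') (ev X_var x' y')"
      and "orb (ev Y_var x y) (ev X_var x y) = orb (ev Y_var x' y') (ev X_var x' y')"
      by (simp_all only: ev_simps)
  qed simp_all
  then obtain \<alpha> where \<alpha>: "\<alpha> \<in> Aut V" "\<And>x y. \<alpha> (orb x y) = orb y x" by auto
  show ?thesis
    by (rule conjugateI[OF A1_fibration_x A1_fibration_y \<alpha>(1) affine_Aut[of 1 0]]) (simp_all add: \<alpha>(2))
qed

text \<open>
  The invariant \<open>x y\<^sup>b\<close> vanishes on the exceptional fibre \<open>x = 0\<close> of \<open>x\<^sup>d\<close>, and divided by \<open>x\<close> it
  has degree \<open>b\<close> there.  The invariants vanishing on \<open>y = 0\<close> are of the form \<open>y w\<close>, and the weight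
  of \<open>w\<close> makes its degree on \<open>y = 0\<close> congruent to \<open>-e\<close>.  An automorphism that conjugates the two
  fibrations carries the first situation into the second, so \<open>b \<equiv> -e\<close> while \<open>e b \<equiv> -1\<close>.
\<close>

lemma coordinate_fibrations_not_conjugate:
  assumes "(x_fibration, y_fibration) \<in> conjugate_fibrations V"
  shows "[e\<^sup>2 = 1] (mod d)"
proof (cases "d = 1")
  case False
  then have d2: "d \<ge> 2" using d_pos by simp
  obtain \<alpha> \<beta> where \<alpha>: "\<alpha> \<in> Aut V" and \<beta>: "\<beta> \<in> Aut affine_line"
    and eq: "y_fibration = compose (points V) \<beta> (compose (points V) x_fibration \<alpha>)"
    using assms unfolding conjugate_fibrations_def by blast
  obtain c c0 where c: "c \<noteq> 0" "\<And>z. \<beta> z = c * z + c0" using Aut_affine_line[OF \<beta>] by blast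
  obtain \<alpha>' where \<alpha>': "\<And>P. P \<in> points V \<Longrightarrow> \<alpha>' (\<alpha> P) = P" using \<alpha> by (rule Aut_inverse) blast
  have \<alpha>_orb: "\<exists>x1 y1. \<alpha> (orb x y) = orb x1 y1" for x y
    using Aut_points[OF \<alpha> orb_in_V] by (auto simp: points_V)
  have \<alpha>_inj: "orb x y = orb x' y'" if "\<alpha> (orb x y) = \<alpha> (orb x' y')" for x y x' y'
    using that \<alpha>'[OF orb_in_V] by metis
  have pull: "\<exists>h'. invariant h' \<and> (\<forall>x y. ev h' x y = descend h (\<alpha> (orb x y)))" if "invariant h" for h
  proof -
    have "compose (points V) (descend h) \<alpha> \<in> regular V"
      using \<alpha> descend_in_regular[OF that] by (simp add: Aut_def isomorphism_def morphism_def)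
    then obtain h' where h': "invariant h'" "compose (points V) (descend h) \<alpha> = descend h'"
      by (auto simp: regular_V)
    have "ev h' x y = descend h (\<alpha> (orb x y))" for x y
      using fun_cong[OF h'(2), of "orb x y"] h'(1) by (simp add: compose_def)
    with h'(1) show ?thesis by blast
  qed
  note inv_xy = invariant_generators(3)
  obtain X where X: "\<And>x y. ev X x y = descend (X_var ^ d) (\<alpha> (orb x y))"
    using pull[of "X_var ^ d"] by auto
  obtain Y where Y: "invariant Y" "\<And>x y. ev Y x y = descend (Y_var ^ d) (\<alpha> (orb x y))"
    using pull[of "Y_var ^ d"] by auto
  obtain U where U: "invariant U" "\<And>x y. ev U x y = descend (X_var ^ 1 * Y_var ^ b) (\<alpha> (orb x y))"
    using pull[OF inv_xy] by auto
  have vals: "\<exists>x1 y1. \<alpha> (orb x y) = orb x1 y1 \<and> ev X x y = x1 ^ d \<and> ev Y x y = y1 ^ d \<and> ev U x y = x1 * y1 ^ b"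
    for x y
  proof -
    obtain x1 y1 where xy: "\<alpha> (orb x y) = orb x1 y1" using \<alpha>_orb by blast
    then show ?thesis using descend_orb[OF inv_xy] by (auto simp: X Y U)
  qed
  have UXY: "U ^ d = X * Y ^ b"
  proof (rule ev_eqI)
    fix x y
    obtain x1 y1 where "ev X x y = x1 ^ d" "ev Y x y = y1 ^ d" "ev U x y = x1 * y1 ^ b" using vals by blast
    then show "ev (U ^ d) x y = ev (X * Y ^ b) x y"
      by (simp add: power_mult_distrib mult.commute[of b] flip: power_mult)
  qed
  have cX: "const c * X = Y_var ^ d - const c0"
  proof (rule ev_eqI)
    fix x y
    have "y_fibration (orb x y) = \<beta> (x_fibration (\<alpha> (orb x y)))"
      by (subst eq) (simp add: compose_def)
    then show "ev (const c * X) x y = ev (Y_var ^ d - const c0) x y" by (simp add: c X)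
  qed
  (* On X = 0 the function Y alone separates orbits, since y^d does so on x = 0. *)
  have separated: "\<exists>k. x' = \<zeta> ^ k * x"
    if "ev X x y = 0" "ev X x' y' = 0" "ev Y x y = ev Y x' y'" for x y x' y'
  proof -
    obtain x1 y1 where 1: "\<alpha> (orb x y) = orb x1 y1" "ev X x y = x1 ^ d" "ev Y x y = y1 ^ d" using vals by blast
    obtain x2 y2 where 2: "\<alpha> (orb x' y') = orb x2 y2" "ev X x' y' = x2 ^ d" "ev Y x' y' = y2 ^ d" using vals by blast
    have "x1 = 0" "x2 = 0" "y1 ^ d = y2 ^ d" using that 1 2 by auto
    then have "orb x1 y1 = orb x2 y2" by (intro orb_eqI) auto
    then have "orb x y = orb x' y'" using 1(1) 2(1) \<alpha>_inj by simp
    then show ?thesis by (auto simp: orb_eq_iff)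
  qed
  (* If c0 were nonzero, X would have a simple zero along y = r.  Since X Y^b is a d-th power and
     d > 1, also Y would vanish on that line, but X and Y vanish together only in one orbit. *)
  have "c0 = 0"
  proof (rule ccontr)
    assume "c0 \<noteq> 0"
    obtain r where r: "r ^ d = c0" using nth_root_exists[OF d_pos] by blast
    with \<open>c0 \<noteq> 0\<close> d_pos have "r \<noteq> 0" by auto
    let ?\<pi> = "Y_var - const r"
    have \<pi>: "?\<pi> \<noteq> 0"
    proof
      assume "?\<pi> = 0"
      then have "ev ?\<pi> 0 (r + 1) = 0" by simp
      then show False by simp
    qed
    have X0: "ev X x r = 0" for x
    proof -
      have "ev (const c * X) x r = 0" unfolding cX by (simp add: r)
      then show ?thesis using c(1) by simp
    qed
    have "ev U x r = 0" for x
    proof -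
      have "ev (U ^ d) x r = 0" unfolding UXY by (simp add: X0)
      then show ?thesis by simp
    qed
    then have "?\<pi> dvd U" by (rule poly_at_constant_dvd)
    then obtain U1 where U1: "U = ?\<pi> * U1" by (elim dvdE)
    have "?\<pi> dvd Y_var ^ d - const c0" by (rule poly_at_constant_dvd) (simp add: r)
    then obtain R where R: "Y_var ^ d - const c0 = ?\<pi> * R" by (elim dvdE)
    have R_r: "ev R x r \<noteq> 0" for x
    proof -
      have "ev (dy (Y_var ^ d - const c0)) x r = ev R x r" unfolding R by simp
      then show ?thesis using \<open>r \<noteq> 0\<close> d_pos by (auto simp: ev_power_derivatives)
    qed
    obtain n where n: "d = Suc (Suc n)" using d2 by (metis add_2_eq_Suc le_Suc_ex)
    have "?\<pi> * (const c * (?\<pi> ^ Suc n * U1 ^ d)) = const c * U ^ d"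
      unfolding U1 power_mult_distrib by (simp add: n)
    also have "\<dots> = ?\<pi> * (R * Y ^ b)" by (simp only: UXY mult.assoc[symmetric] cX R)
    finally have "const c * (?\<pi> ^ Suc n * U1 ^ d) = R * Y ^ b" using \<pi> by (simp only: mult_left_cancel simp_thms)
    then have "ev (const c * (?\<pi> ^ Suc n * U1 ^ d)) x r = ev (R * Y ^ b) x r" for x by simp
    then have "ev Y x r = 0" for x using R_r[of x] by auto
    then obtain k where "1 = \<zeta> ^ k * 0" using separated[of 0 r 1 r] X0 by metis
    then show False by simp
  qed
  have X_eq: "ev X x y = y ^ d / c" for x y
    using arg_cong[OF cX, of "\<lambda>h. ev h x y"] c(1) \<open>c0 = 0\<close> by (simp add: field_simps)
  have X0: "ev X x 0 = 0" for x using d_pos by (simp add: X_eq)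
  have "ev U x 0 = 0" for x
  proof -
    have "ev (U ^ d) x 0 = 0" unfolding UXY by (simp add: X0)
    then show ?thesis by simp
  qed
  then have "Y_var - const 0 dvd U" by (rule poly_at_constant_dvd)
  then have "Y_var dvd U" by simp
  then obtain w where w: "U = Y_var * w" by (elim dvdE)
  have Y_nz: "Y_var \<noteq> 0" by (simp add: Y_var_def)
  have "Y_var ^ d * (const c * w ^ d) = const c * U ^ d"
    unfolding w power_mult_distrib by (simp only: ac_simps)
  also have "\<dots> = Y_var ^ d * Y ^ b" using \<open>c0 = 0\<close> by (simp add: UXY mult.assoc[symmetric] cX)
  finally have wY: "const c * w ^ d = Y ^ b" using Y_nz by simp
  have "Y_var * (const (\<zeta> ^ e) * act 1 w) = act 1 U"
    unfolding w by (rule ev_eqI) simp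
  also have "\<dots> = Y_var * w" unfolding act_invariant[OF U(1)] by (rule w)
  finally have act_w: "const (\<zeta> ^ e) * act 1 w = w" using Y_nz by (simp only: mult_left_cancel simp_thms)
  define w0 where "w0 = along w [:0, 1:] 0"
  define Y0 where "Y0 = along Y [:0, 1:] 0"
  have w0: "poly w0 x = ev w x 0" and Y0: "poly Y0 x = ev Y x 0" for x by (simp_all add: w0_def Y0_def)
  have Y0_sep: "\<exists>k. x' = \<zeta> ^ k * x" if "poly Y0 x = poly Y0 x'" for x x'
    using separated[OF X0 X0] that by (simp add: Y0)
  have "x = 0" if "poly Y0 x = poly Y0 0" for x using Y0_sep[OF that[symmetric]] by auto
  then have deg0: "degree Y0 > 0" and Y0_eq: "Y0 = monom (lead_coeff Y0) (degree Y0) + [:poly Y0 0:]"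
    using value_injective_imp_monom[of Y0] by auto
  have Y0_val: "poly Y0 z = lead_coeff Y0 * z ^ degree Y0 + poly Y0 0" for z
    using arg_cong[OF Y0_eq, of "\<lambda>p. poly p z"] unfolding poly_add poly_monom by simp
  (* Up to an additive constant Y0 is a monomial.  It separates points up to d-th roots of unity,
     which bounds its degree above, and it is invariant under them, which bounds it below. *)
  have "degree Y0 = d"
  proof (rule antisym)
    have "z ^ d = 1" if "z ^ degree Y0 = 1" for z :: complex
    proof -
      have "poly Y0 1 = poly Y0 z" unfolding Y0_val[of 1] Y0_val[of z] that by simp
      then obtain k where "z = \<zeta> ^ k * 1" using Y0_sep by blast
      then show ?thesis by (simp add: root_power_eq_1_iff flip: power_mult)
    qed
    then have "{z::complex. z ^ degree Y0 = 1} \<subseteq> {z. z ^ d = 1}" by blast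
    moreover have "finite {z::complex. z ^ d = 1}" using d_pos by (intro finite_roots_unity) simp
    ultimately have "card {z::complex. z ^ degree Y0 = 1} \<le> card {z::complex. z ^ d = 1}" by (rule card_mono[rotated])
    then show "degree Y0 \<le> d" using deg0 d_pos by (simp add: card_roots_unity_eq)
    have "poly Y0 \<zeta> = poly Y0 1"
      using Y(1) unfolding invariant_def Y0 by (metis mult_1_right mult_zero_right)
    then have "lead_coeff Y0 * \<zeta> ^ degree Y0 = lead_coeff Y0"
      unfolding Y0_val[of 1] Y0_val[of \<zeta>] by simp
    moreover have "lead_coeff Y0 \<noteq> 0" using deg0 by auto
    ultimately have "d dvd degree Y0" by (simp add: root_power_eq_1_iff)
    then show "d \<le> degree Y0" using deg0 by (rule dvd_imp_le)
  qed
  have "poly (smult c (w0 ^ d)) x = poly (Y0 ^ b) x" for x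
    using arg_cong[OF wY, of "\<lambda>h. ev h x 0"] by (simp add: w0 Y0)
  then have w0Y0: "smult c (w0 ^ d) = Y0 ^ b" by (simp add: poly_eq_poly_eq_iff[symmetric] fun_eq_iff)
  have "w0 \<noteq> 0"
  proof
    assume "w0 = 0"
    then have "Y0 ^ b = 0" using w0Y0 d_pos by (simp add: power_0_left)
    then show False using deg0 by auto
  qed
  have "Y0 \<noteq> 0" using deg0 by auto
  have "d * degree w0 = degree (smult c (w0 ^ d))" using \<open>w0 \<noteq> 0\<close> c(1) by (simp add: degree_power_eq)
  also have "\<dots> = b * degree Y0" unfolding w0Y0 using \<open>Y0 \<noteq> 0\<close> by (simp add: degree_power_eq)
  finally have "d * degree w0 = d * b" unfolding \<open>degree Y0 = d\<close> by (simp only: mult.commute)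
  then have "degree w0 = b" using d_pos by auto
  have "poly (smult (\<zeta> ^ e) (pcompose w0 [:0, \<zeta>:])) x = poly w0 x" for x
    using arg_cong[OF act_w, of "\<lambda>h. ev h x 0"] by (simp add: w0 poly_pcompose mult.commute)
  then have "smult (\<zeta> ^ e) (pcompose w0 [:0, \<zeta>:]) = w0" by (simp add: poly_eq_poly_eq_iff[symmetric] fun_eq_iff)
  then have "\<zeta> ^ e * (\<zeta> ^ b * coeff w0 b) = coeff w0 b"
    by (metis coeff_smult coeff_pcompose_linear)
  moreover have "coeff w0 b \<noteq> 0" using \<open>w0 \<noteq> 0\<close> unfolding \<open>degree w0 = b\<close>[symmetric] by simp
  ultimately have "\<zeta> ^ (e + b) = 1" by (simp add: power_add)
  then have "\<zeta> ^ (e * (e + b)) = 1" by (metis mult.commute power_mult power_one)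
  moreover have "\<zeta> ^ (1 + e * b) = 1" using b by (simp only: root_power_eq_1_iff)
  ultimately have "[e * e + e * b = 1 + e * b] (mod d)"
    by (simp only: root_power_eq_iff[symmetric] distrib_left)
  then show ?thesis by (simp only: cong_add_rcancel_nat power2_eq_square)
qed simp

lemma fibration_classes_V:
  "fibration_classes V = {conjugate_fibrations V `` {x_fibration}, conjugate_fibrations V `` {y_fibration}}"
proof -
  note eqv = equiv_conjugate_fibrations_toric_surface[of \<zeta> e]
  show ?thesis
    unfolding fibration_classes_def
  proof (intro subset_antisym subsetI)
    fix C assume "C \<in> Collect (A1_fibration V) // conjugate_fibrations V"
    then obtain \<phi> where \<phi>: "A1_fibration V \<phi>" "C = conjugate_fibrations V `` {\<phi>}"
      by (auto elim: quotientE)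
    from fibration_conjugate_to_coordinate[OF \<phi>(1)]
    show "C \<in> {conjugate_fibrations V `` {x_fibration}, conjugate_fibrations V `` {y_fibration}}"
      using equiv_class_eq[OF eqv] \<phi>(2) by blast
  next
    fix C assume "C \<in> {conjugate_fibrations V `` {x_fibration}, conjugate_fibrations V `` {y_fibration}}"
    then show "C \<in> Collect (A1_fibration V) // conjugate_fibrations V"
      using A1_fibration_x A1_fibration_y by (auto intro: quotientI)
  qed
qed

end

theorem proposition5p15:
  fixes d e :: nat and \<zeta> :: complex
  assumes "d \<ge> 1" and "e < d" and "coprime e d"
    and "primitive_root_of_unity d \<zeta>"
  shows "finite (fibration_classes (toric_surface \<zeta> e)) \<and>
         card (fibration_classes (toric_surface \<zeta> e)) \<le> 2 \<and>
         (card (fibration_classes (toric_surface \<zeta> e)) = 1 \<longleftrightarrow> [e\<^sup>2 = 1] (mod d))"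
proof -
  interpret cyclic_quotient d e \<zeta>
    using assms by unfold_locales auto
  note eqv = equiv_conjugate_fibrations_toric_surface[of \<zeta> e]
  let ?x = "conjugate_fibrations V `` {x_fibration}" and ?y = "conjugate_fibrations V `` {y_fibration}"
  have "?x = ?y \<longleftrightarrow> (x_fibration, y_fibration) \<in> conjugate_fibrations V"
    using A1_fibration_x A1_fibration_y by (intro eq_equiv_class_iff[OF eqv]) auto
  also have "\<dots> \<longleftrightarrow> [e\<^sup>2 = 1] (mod d)"
    using coordinate_fibrations_conjugate coordinate_fibrations_not_conjugate by blast
  finally show ?thesis
    unfolding fibration_classes_V by (auto simp: card_insert_if)
qed

end
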